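(* Let $G$ be a finite $p$-group of order $n\geq 3$. Then the following are equivalent: (i) the algebraic connectivity of $\mathcal{G}(G)$ is $1$; (ii) the multiplicity of the Laplacian eigenvalue $n$ of $\mathcal{G}(G)$ is one; (iii) $G$ is neither cyclic nor generalized quaternion.
   Context: $p$ is a prime; a $p$-group is a group of order at least two in which every element has order a power of $p$. A generalized quaternion group is a group of order $4n$, $n$ a power of $2$ with $n\ge2$, with presentation $\langle a,b\mid a^{2n}=e, a^n=b^2, ab=ba^{-1}\rangle$. The power graph $\mathcal{G}(G)$ has vertex set $G$, distinct $u,v$ adjacent iff one is a positive power of the other. Laplacian eigenvalues are eigenvalues of $L=D-A$; for a graph on $n$ vertices, the algebraic connectivity is the second smallest Laplacian eigenvalue $\lambda_{n-1}$. *)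

theory Defs
  imports
    "HOL-Algebra.Elementary_Groups"
    "HOL-Algebra.Multiplicative_Group"
    "HOL-Computational_Algebra.Polynomial"
    "HOL-Library.Multiset"
    "Jordan_Normal_Form.Char_Poly"
    "Graph_Theory.Pair_Digraph"
begin

section \<open>p-groups\<close>

text \<open>\<^const>\<open>Coset.order\<close> is 0 for infinite groups, and so is \<^const>\<open>group.ord\<close> for elements of
  infinite order.\<close>

definition p_group :: "nat \<Rightarrow> ('a, 'b) monoid_scheme \<Rightarrow> bool" where
  "p_group p G \<longleftrightarrow> prime p \<and> group G \<and> (infinite (carrier G) \<or> Coset.order G \<ge> 2) \<and>
     (\<forall>x \<in> carrier G. \<exists>k::nat. group.ord G x = p ^ k)"


section \<open>Group presentations and generalized quaternion groups\<close>

text \<open>A word over the generators \<^typ>\<open>'x\<close> and their formal inverses: the letter \<open>(x, True)\<close>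
  stands for \<open>x\<close> and \<open>(x, False)\<close> for its inverse. The group presented by a set \<open>R\<close> of relations
  (pairs of words, read as equations) on the generators \<^term>\<open>UNIV :: 'x set\<close> is the quotient of
  the monoid of words by the congruence \<open>word_cong R\<close>.\<close>

type_synonym 'x word = "('x \<times> bool) list"

inductive word_cong :: "('x word \<times> 'x word) set \<Rightarrow> 'x word \<Rightarrow> 'x word \<Rightarrow> bool"
  for R :: "('x word \<times> 'x word) set" where
  rel: "(u, v) \<in> R \<Longrightarrow> word_cong R u v"
| cancel: "word_cong R [(x, s), (x, \<not> s)] []"
| refl: "word_cong R u u"
| sym: "word_cong R u v \<Longrightarrow> word_cong R v u"
| trans: "word_cong R u v \<Longrightarrow> word_cong R v w \<Longrightarrow> word_cong R u w"
| append: "word_cong R u u' \<Longrightarrow> word_cong R v v' \<Longrightarrow> word_cong R (u @ v) (u' @ v')"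

primrec word_eval :: "('a, 'b) monoid_scheme \<Rightarrow> ('x \<Rightarrow> 'a) \<Rightarrow> 'x word \<Rightarrow> 'a" where
  "word_eval G f [] = \<one>\<^bsub>G\<^esub>"
| "word_eval G f (l # w) =
     (if snd l then f (fst l) else inv\<^bsub>G\<^esub> (f (fst l))) \<otimes>\<^bsub>G\<^esub> word_eval G f w"

text \<open>Evaluation at the images \<open>f x\<close> of the generators induces an isomorphism from the presented
  group onto \<open>G\<close>.\<close>

definition has_presentation :: "('a, 'b) monoid_scheme \<Rightarrow> ('x word \<times> 'x word) set \<Rightarrow> bool" where
  "has_presentation G R \<longleftrightarrow> (\<exists>f. range f \<subseteq> carrier G \<and> range (word_eval G f) = carrier G \<and>
     (\<forall>u v. word_eval G f u = word_eval G f v \<longleftrightarrow> word_cong R u v))"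

datatype quaternion_gen = Gen_a | Gen_b

definition quaternion_relations :: "nat \<Rightarrow> (quaternion_gen word \<times> quaternion_gen word) set" where
  "quaternion_relations n =
     {(replicate (2 * n) (Gen_a, True), []),
      (replicate n (Gen_a, True), replicate 2 (Gen_b, True)),
      ([(Gen_a, True), (Gen_b, True)], [(Gen_b, True), (Gen_a, False)])}"

definition generalized_quaternion :: "('a, 'b) monoid_scheme \<Rightarrow> bool" where
  "generalized_quaternion G \<longleftrightarrow> group G \<and>
     (\<exists>n::nat. n \<ge> 2 \<and> (\<exists>m. n = 2 ^ m) \<and> Coset.order G = 4 * n \<and>
       has_presentation G (quaternion_relations n))"


section \<open>The power graph\<close>

text \<open>An undirected graph is represented by the digraph with both orientations of every edge.\<close>

definition power_graph :: "('a, 'b) monoid_scheme \<Rightarrow> 'a pair_pre_digraph" where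
  "power_graph G = \<lparr> pverts = carrier G,
     parcs = {(u, v). u \<in> carrier G \<and> v \<in> carrier G \<and> u \<noteq> v \<and>
       (\<exists>k::nat. k > 0 \<and> (u = v [^]\<^bsub>G\<^esub> k \<or> v = u [^]\<^bsub>G\<^esub> k))} \<rparr>"


section \<open>Laplacian eigenvalues\<close>

text \<open>The rows and columns are indexed by an arbitrary enumeration of the (finitely many) vertices;
  another choice conjugates all three matrices by the same permutation matrix.\<close>

definition vertex_list :: "'a pair_pre_digraph \<Rightarrow> 'a list" where
  "vertex_list \<Gamma> = (SOME vs. distinct vs \<and> set vs = pverts \<Gamma>)"

definition adjacency_mat :: "'a pair_pre_digraph \<Rightarrow> real mat" where
  "adjacency_mat \<Gamma> = (let vs = vertex_list \<Gamma> in
     mat (length vs) (length vs) (\<lambda>(i, j). if (vs ! i, vs ! j) \<in> parcs \<Gamma> then 1 else 0))"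

definition degree_mat :: "'a pair_pre_digraph \<Rightarrow> real mat" where
  "degree_mat \<Gamma> = (let vs = vertex_list \<Gamma> in
     mat (length vs) (length vs)
       (\<lambda>(i, j). if i = j then real (out_degree (with_proj \<Gamma>) (vs ! i)) else 0))"

definition laplacian_mat :: "'a pair_pre_digraph \<Rightarrow> real mat" where
  "laplacian_mat \<Gamma> = degree_mat \<Gamma> - adjacency_mat \<Gamma>"

text \<open>The eigenvalues with multiplicity. The Laplacian of an undirected graph is a real symmetric
  matrix, so its characteristic polynomial splits over the reals and none is lost.\<close>

definition laplacian_spectrum :: "'a pair_pre_digraph \<Rightarrow> real multiset" where
  "laplacian_spectrum \<Gamma> = proots (char_poly (laplacian_mat \<Gamma>))"

definition laplacian_multiplicity :: "'a pair_pre_digraph \<Rightarrow> real \<Rightarrow> nat" where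
  "laplacian_multiplicity \<Gamma> \<mu> = count (laplacian_spectrum \<Gamma>) \<mu>"

text \<open>\<^const>\<open>sorted_list_of_multiset\<close> is increasing, so index 1 is the second smallest eigenvalue;
  it exists for graphs with at least two vertices.\<close>

definition algebraic_connectivity :: "'a pair_pre_digraph \<Rightarrow> real" where
  "algebraic_connectivity \<Gamma> = sorted_list_of_multiset (laplacian_spectrum \<Gamma>) ! 1"

end

theory Submission
  imports Defs "HOL-Algebra.Sylow" "HOL-Algebra.Group_Action" "HOL-Number_Theory.Residues"
begin

text \<open>If \<open>\<Gamma>\<close> on \<open>n\<close> vertices arises from \<open>H\<close> by adding a dominating vertex, the Laplacian
  characteristic polynomials satisfy \<open>(x - 1) \<chi>\<^sub>\<Gamma>(x) = x (x - n) \<chi>\<^sub>H(x - 1)\<close>. In the power graph the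
  identity is dominating. If there is a second dominating vertex, then \<open>n\<close> is at least a double
  eigenvalue, and all eigenvalues apart from one \<open>0\<close> are at least \<open>2\<close>. If the graph falls apart
  after removing the identity, then \<open>n\<close> is simple and the second smallest eigenvalue is \<open>1\<close>.

  In a cyclic \<open>p\<close>-group a generator is a second dominating vertex, and in a generalized quaternion
  group the unique involution is. Every other \<open>p\<close>-group has two distinct subgroups of order \<open>p\<close>, and
  no edge joins elements lying above different subgroups of order \<open>p\<close>.\<close>

section \<open>Laplacian characteristic polynomials\<close>

text \<open>The factor \<open>x - 1\<close> comes from the all-ones vector: it is an eigenvector of
  \<open>H\<close> for 0, and adding a dominating vertex replaces this eigenvalue by 0 and
  \<open>n\<close>, while all others move up by 1. Comparing roots as multisets settles
  multiplicities without diagonalizing anything. If \<open>H\<close> falls into two pieces, the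
  eigenvalues of a piece are at most its size, so after the shift they stay below \<open>n\<close>,
  and the second all-ones vector leaves the eigenvalue 1. Most of the work is the classical fact
  that a finite p-group with a single subgroup of order p is cyclic or generalized quaternion. The
  obstacle is the prime 2. An element normalizing a cyclic subgroup raises the generator to some
  power r. Multiplying it by a suitable power of the generator gives a new element of order p
  whenever \<open>1 + r + ... + r^(p-1)\<close> is p times a unit, and this fails only for p = 2 and
  r = 3 modulo 4.\<close>

definition list_degree :: "('v \<Rightarrow> 'v \<Rightarrow> bool) \<Rightarrow> 'v list \<Rightarrow> 'v \<Rightarrow> real" where
  "list_degree R vs v = (\<Sum>j<length vs. of_bool (R v (vs ! j)))"

text \<open>\<open>lap_poly R vs c\<close> is the characteristic polynomial of the Laplacian evaluated at \<open>x - c\<close>. The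
  shift is built in because removing a dominating vertex decreases all other degrees by one.\<close>

definition lap_charmat :: "('v \<Rightarrow> 'v \<Rightarrow> bool) \<Rightarrow> 'v list \<Rightarrow> real \<Rightarrow> real poly mat" where
  "lap_charmat R vs c = mat (length vs) (length vs) (\<lambda>(i, j).
     (if i = j then [:- c - list_degree R vs (vs ! i), 1:] else 0) + of_bool (R (vs ! i) (vs ! j)))"

definition lap_poly :: "('v \<Rightarrow> 'v \<Rightarrow> bool) \<Rightarrow> 'v list \<Rightarrow> real \<Rightarrow> real poly" where
  "lap_poly R vs c = det (lap_charmat R vs c)"

lemma lap_charmat_carrier [simp]: "lap_charmat R vs c \<in> carrier_mat (length vs) (length vs)"
  by (simp add: lap_charmat_def)

lemma list_degree_conv_sum:
  assumes "distinct vs"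
  shows "list_degree R vs v = (\<Sum>w\<in>set vs. of_bool (R v w))"
proof -
  have "bij_betw ((!) vs) {..<length vs} (set vs)"
    using assms by (simp add: bij_betw_nth)
  then show ?thesis unfolding list_degree_def
    by (rule sum.reindex_bij_betw)
qed

lemma list_degree_Cons: "list_degree R (e # vs) v = of_bool (R v e) + list_degree R vs v"
  by (simp add: list_degree_def sum.lessThan_Suc_shift del: sum.lessThan_Suc)

lemma list_degree_append: "list_degree R (us @ ws) v = list_degree R us v + list_degree R ws v"
  by (induction us) (simp_all add: list_degree_Cons, simp add: list_degree_def)

text \<open>Rows and columns each contribute the sign of \<open>p\<close>, and the two signs cancel;
  the columns are reached by transposing.\<close>

lemma det_permute_both:
  fixes A :: "'a :: comm_ring_1 mat"
  assumes A: "A \<in> carrier_mat n n" and p: "p permutes {0..<n}"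
  shows "det (mat n n (\<lambda>(i, j). A $$ (p i, p j))) = det A"
proof -
  define B where "B = mat n n (\<lambda>(i, j). A $$ (p i, j))"
  have B: "B \<in> carrier_mat n n" by (simp add: B_def)
  have pl: "p i < n" if "i < n" for i
    using permutes_in_image[OF p, of i] that by simp
  have "mat n n (\<lambda>(i, j). A $$ (p i, p j))
      = transpose_mat (mat n n (\<lambda>(i, j). transpose_mat B $$ (p i, j)))"
    by (rule eq_matI) (auto simp: B_def pl)
  also have "det \<dots> = det (mat n n (\<lambda>(i, j). transpose_mat B $$ (p i, j)))"
    by (rule det_transpose[of _ n]) simp
  also have "\<dots> = signof p * det (transpose_mat B)"
    by (rule det_permute_rows[OF _ p]) (use B in simp)
  also have "det (transpose_mat B) = signof p * det A"
    unfolding det_transpose[OF B] unfolding B_def by (rule det_permute_rows[OF A p])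
  finally show ?thesis by (simp add: sign_def split: if_splits)
qed

text \<open>Frees the argument from the arbitrary enumeration \<open>vertex_list\<close>, so that
  dominating vertices can be listed first.\<close>

lemma lap_poly_eqI_set:
  assumes "distinct vs" "distinct ws" "set vs = set ws"
  shows "lap_poly R vs c = lap_poly R ws c"
proof -
  let ?n = "length ws"
  have len: "length vs = ?n" using assms by (metis distinct_card)
  have "mset vs = mset ws" using assms set_eq_iff_mset_eq_distinct by blast
  then obtain p where p: "p permutes {..<length ws}" "permute_list p ws = vs"
    by (rule mset_eq_permutation)
  have p': "p permutes {0..<?n}" using p(1) by (simp add: atLeast0LessThan)
  have nth: "vs ! i = ws ! p i" if "i < ?n" for i
    using that p permute_list_nth by fastforce
  have pl: "p i < ?n" if "i < ?n" for i
    using permutes_in_image[OF p', of i] that by simp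
  have inj: "p i = p j \<longleftrightarrow> i = j" for i j
    using permutes_inj[OF p(1)] by (auto dest: injD)
  have deg: "list_degree R vs v = list_degree R ws v" for v
    using assms by (simp add: list_degree_conv_sum)
  have "lap_charmat R vs c = mat ?n ?n (\<lambda>(i, j). lap_charmat R ws c $$ (p i, p j))"
    by (rule eq_matI) (auto simp: lap_charmat_def len nth pl inj deg)
  then show ?thesis
    unfolding lap_poly_def by (simp add: det_permute_both[OF _ p'])
qed

text \<open>Without edges across, the degrees within either list are unchanged and the matrix is
  block diagonal.\<close>

lemma lap_poly_append:
  assumes "\<And>u w. u \<in> set us \<Longrightarrow> w \<in> set ws \<Longrightarrow> \<not> R u w \<and> \<not> R w u"
  shows "lap_poly R (us @ ws) c = lap_poly R us c * lap_poly R ws c"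
proof -
  let ?n = "length us" and ?m = "length ws"
  have d1: "list_degree R ws u = 0" if "u \<in> set us" for u
    unfolding list_degree_def using assms that by (intro sum.neutral) auto
  have d2: "list_degree R us w = 0" if "w \<in> set ws" for w
    unfolding list_degree_def using assms that by (intro sum.neutral) auto
  have "lap_charmat R (us @ ws) c =
      four_block_mat (lap_charmat R us c) (0\<^sub>m ?n ?m) (0\<^sub>m ?m ?n) (lap_charmat R ws c)"
    by (rule eq_matI)
      (auto simp: lap_charmat_def nth_append list_degree_append d1 d2 assms less_diff_conv2)
  then show ?thesis
    unfolding lap_poly_def by (simp add: det_four_block_mat_upper_right_zero[of _ ?n _ ?m])
qed

text \<open>Every row of the block for \<open>vs\<close> sums to \<open>x - c - 1\<close>, so one column operation clears the
  first column below the diagonal.\<close>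

lemma lap_poly_Cons_dominating:
  assumes "\<not> R e e" and dom: "\<And>v. v \<in> set vs \<Longrightarrow> R e v \<and> R v e"
  shows "lap_poly R (e # vs) c * [:- (c + 1), 1:] =
    [:- c, 1:] * [:- (c + 1 + real (length vs)), 1:] * lap_poly R vs (c + 1)"
proof -
  let ?n = "length vs"
  define \<alpha> where "\<alpha> = [:- c - real ?n, 1 :: real:]"
  define \<beta> where "\<beta> = [:- (c + 1), 1 :: real:]"
  define B where "B = lap_charmat R vs (c + 1)"
  have B: "B \<in> carrier_mat ?n ?n" by (simp add: B_def)
  define J where "J = mat 1 ?n (\<lambda>_. 1 :: real poly)"
  define K where "K = mat ?n 1 (\<lambda>_. 1 :: real poly)"
  have J: "J \<in> carrier_mat 1 ?n" and K: "K \<in> carrier_mat ?n 1" by (simp_all add: J_def K_def)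
  let ?A = "mat 1 1 (\<lambda>_. \<alpha>)" and ?B = "mat 1 1 (\<lambda>_. \<beta>)"
  have dege: "list_degree R vs e = real ?n"
    unfolding list_degree_def using dom by simp
  have M: "lap_charmat R (e # vs) c = four_block_mat ?A J K B"
    by (rule eq_matI)
      (auto simp: lap_charmat_def B_def J_def K_def \<alpha>_def list_degree_Cons dege assms nth_Cons'
        less_Suc_eq_0_disj algebra_simps)
  \<comment> \<open>Right multiplication by \<open>?U\<close> replaces the first column by
    \<open>\<beta>\<close> times itself minus the sum of all the others. Its determinant
    \<open>\<beta>\<close> is the extra factor on the left of the claim.\<close>
  let ?U = "four_block_mat ?B (0\<^sub>m 1 ?n) (- K) (1\<^sub>m ?n)"
  have rowsum: "(\<Sum>j<?n. B $$ (i, j)) = \<beta>" if "i < ?n" for i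
  proof -
    have "(\<Sum>j<?n. B $$ (i, j)) = [:- (c + 1) - list_degree R vs (vs ! i), 1:]
        + (\<Sum>j<?n. of_bool (R (vs ! i) (vs ! j)))"
      using that by (simp add: B_def lap_charmat_def sum.distrib)
    also have "(\<Sum>j<?n. of_bool (R (vs ! i) (vs ! j))) = [:list_degree R vs (vs ! i):]"
      unfolding list_degree_def by (simp add: of_nat_poly)
    finally show ?thesis by (simp add: \<beta>_def)
  qed
  have 1: "?A * ?B + J * (- K) = mat 1 1 (\<lambda>_. \<alpha> * \<beta> - of_nat ?n)"
    by (rule eq_matI) (auto simp: J_def K_def scalar_prod_def)
  have 2: "?A * 0\<^sub>m 1 ?n + J * 1\<^sub>m ?n = J" using J by simp
  have 3: "K * ?B + B * (- K) = 0\<^sub>m ?n 1"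
    using B by (intro eq_matI) 
      (auto simp: K_def scalar_prod_def rowsum sum_negf atLeast0LessThan)
  have 4: "K * 0\<^sub>m 1 ?n + B * 1\<^sub>m ?n = B" using B K by simp
  have "four_block_mat ?A J K B * ?U = four_block_mat (?A * ?B + J * (- K))
      (?A * 0\<^sub>m 1 ?n + J * 1\<^sub>m ?n) (K * ?B + B * (- K)) (K * 0\<^sub>m 1 ?n + B * 1\<^sub>m ?n)"
    by (rule mult_four_block_mat[OF _ J K B]) (use K in auto)
  then have "lap_charmat R (e # vs) c * ?U
      = four_block_mat (mat 1 1 (\<lambda>_. \<alpha> * \<beta> - of_nat ?n)) J (0\<^sub>m ?n 1) B"
    unfolding M 1 2 3 4 .
  then have "det (lap_charmat R (e # vs) c * ?U) = (\<alpha> * \<beta> - of_nat ?n) * det B"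
    by (simp add: det_four_block_mat_lower_left_zero_col[OF _ J _ B] det_single)
  moreover have "?U \<in> carrier_mat (Suc ?n) (Suc ?n)"
    using four_block_carrier_mat[of ?B 1 1 "1\<^sub>m ?n" ?n ?n] by simp
  then have "det (lap_charmat R (e # vs) c * ?U) = lap_poly R (e # vs) c * det ?U"
    unfolding lap_poly_def by (intro det_mult[of _ "Suc ?n"]) (simp_all add: lap_charmat_def)
  moreover have "det ?U = \<beta>"
    using det_four_block_mat_upper_right_zero[of ?B 1 "0\<^sub>m 1 ?n" ?n "- K" "1\<^sub>m ?n"] K
    by (simp add: det_single)
  moreover have "\<alpha> * \<beta> - of_nat ?n = [:- c, 1:] * [:- (c + 1 + real ?n), 1:]"
    by (simp add: \<alpha>_def \<beta>_def of_nat_poly algebra_simps)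
  ultimately show ?thesis by (simp add: \<beta>_def B_def lap_poly_def)
qed

section \<open>Roots of the characteristic polynomial and their bounds\<close>

lemma poly_lap_poly:
  "poly (lap_poly R vs c) r = det (mat (length vs) (length vs) (\<lambda>(i, j).
     (if i = j then r - c - list_degree R vs (vs ! i) else 0) + of_bool (R (vs ! i) (vs ! j))))"
  unfolding lap_poly_def
  by (rule poly_det_cong[of _ "length vs"]) (auto simp: lap_charmat_def)

text \<open>A vanishing determinant yields an eigenvector. The degrees are absorbed into the
  differences \<open>x i - x j\<close>, which makes constant vectors visible as kernel elements and
  leads to a quadratic form made of squares.\<close>

lemma lap_poly_root_iff:
  "poly (lap_poly R vs c) r = 0 \<longleftrightarrow> (\<exists>x :: nat \<Rightarrow> real. (\<exists>i<length vs. x i \<noteq> 0) \<and>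
     (\<forall>i<length vs. (r - c) * x i = (\<Sum>j<length vs. of_bool (R (vs ! i) (vs ! j)) * (x i - x j))))"
  (is "_ \<longleftrightarrow> ?rhs")
proof -
  let ?n = "length vs"
  let ?M = "mat ?n ?n (\<lambda>(i, j).
     (if i = j then r - c - list_degree R vs (vs ! i) else 0) + of_bool (R (vs ! i) (vs ! j)))"
  have row: "(?M *\<^sub>v v) $ i = (r - c) * v $ i - (\<Sum>j<?n. of_bool (R (vs ! i) (vs ! j)) * (v $ i - v $ j))"
    if "v \<in> carrier_vec ?n" "i < ?n" for v i
  proof -
    have "(?M *\<^sub>v v) $ i = (\<Sum>j<?n. ((if i = j then r - c - list_degree R vs (vs ! i) else 0)
        + of_bool (R (vs ! i) (vs ! j))) * v $ j)"
      using that by (simp add: scalar_prod_def atLeast0LessThan)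
    also have "\<dots> = (r - c - list_degree R vs (vs ! i)) * v $ i
        + (\<Sum>j<?n. of_bool (R (vs ! i) (vs ! j)) * v $ j)"
      using that by (simp add: distrib_right sum.distrib if_distrib[of "\<lambda>x. x * _"] cong: if_cong)
    also have "\<dots> = (r - c) * v $ i - (\<Sum>j<?n. of_bool (R (vs ! i) (vs ! j)) * (v $ i - v $ j))"
      by (simp add: list_degree_def left_diff_distrib right_diff_distrib sum_subtractf sum_distrib_right)
    finally show ?thesis .
  qed
  have "poly (lap_poly R vs c) r = 0 \<longleftrightarrow> (\<exists>v. v \<in> carrier_vec ?n \<and> v \<noteq> 0\<^sub>v ?n \<and> ?M *\<^sub>v v = 0\<^sub>v ?n)"
    unfolding poly_lap_poly by (rule det_0_iff_vec_prod_zero) simp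
  also have "\<dots> \<longleftrightarrow> ?rhs"
  proof
    assume "\<exists>v. v \<in> carrier_vec ?n \<and> v \<noteq> 0\<^sub>v ?n \<and> ?M *\<^sub>v v = 0\<^sub>v ?n"
    then obtain v where v: "v \<in> carrier_vec ?n" "v \<noteq> 0\<^sub>v ?n" "?M *\<^sub>v v = 0\<^sub>v ?n" by blast
    have "\<exists>i<?n. v $ i \<noteq> 0"
    proof (rule ccontr)
      assume "\<not> (\<exists>i<?n. v $ i \<noteq> 0)"
      then have "v = 0\<^sub>v ?n" using v(1) by (intro eq_vecI) auto
      then show False using v(2) by simp
    qed
    moreover have "(r - c) * v $ i = (\<Sum>j<?n. of_bool (R (vs ! i) (vs ! j)) * (v $ i - v $ j))"
      if "i < ?n" for i
      using row[OF v(1) that] v(3) that by simp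
    ultimately show ?rhs by blast
  next
    assume ?rhs
    then obtain x where x: "\<exists>i<?n. x i \<noteq> 0"
      "\<And>i. i < ?n \<Longrightarrow> (r - c) * x i = (\<Sum>j<?n. of_bool (R (vs ! i) (vs ! j)) * (x i - x j))" by blast
    define v where "v = vec ?n x"
    have v: "v \<in> carrier_vec ?n" by (simp add: v_def)
    have "v \<noteq> 0\<^sub>v ?n" using x(1) by (metis index_vec index_zero_vec(1) v_def)
    moreover have "?M *\<^sub>v v = 0\<^sub>v ?n"
    proof (rule eq_vecI)
      fix i assume "i < dim_vec (0\<^sub>v ?n)"
      then have i: "i < ?n" by simp
      have "(\<Sum>j<?n. of_bool (R (vs ! i) (vs ! j)) * (v $ i - v $ j)) =
        (\<Sum>j<?n. of_bool (R (vs ! i) (vs ! j)) * (x i - x j))"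
        using i by (intro sum.cong) (auto simp: v_def)
      then show "(?M *\<^sub>v v) $ i = 0\<^sub>v ?n $ i" using row[OF v i] x(2)[OF i] i by (simp add: v_def)
    qed simp
    ultimately show "\<exists>v. v \<in> carrier_vec ?n \<and> v \<noteq> 0\<^sub>v ?n \<and> ?M *\<^sub>v v = 0\<^sub>v ?n" using v by blast
  qed
  finally show ?thesis .
qed

text \<open>The all-ones vector lies in the kernel of every Laplacian. The root found here cancels
  the extra linear factor in \<open>lap_poly_Cons_dominating\<close>.\<close>

lemma lap_poly_root_shift: "vs \<noteq> [] \<Longrightarrow> poly (lap_poly R vs c) c = 0"
  unfolding lap_poly_root_iff by (intro exI[of _ "\<lambda>_. 1"]) auto

text \<open>The quadratic form of the Laplacian is \<open>\<Sum> (x\<^sub>i - x\<^sub>j)\<^sup>2 / 2\<close> over the edges, which lies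
  between \<open>0\<close> and the same sum over all pairs of vertices.\<close>

lemma lap_poly_root_bounds:
  assumes sym: "\<And>u v. R u v \<longleftrightarrow> R v u" and root: "poly (lap_poly R vs c) r = 0"
  shows "c \<le> r" and "r \<le> c + real (length vs)"
proof -
  let ?n = "length vs"
  define w where "w i j = (of_bool (R (vs ! i) (vs ! j)) :: real)" for i j
  obtain x where x: "\<exists>i<?n. x i \<noteq> 0"
    "\<And>i. i < ?n \<Longrightarrow> (r - c) * x i = (\<Sum>j<?n. w i j * (x i - x j))"
    using root unfolding lap_poly_root_iff w_def by blast
  define N where "N = (\<Sum>i<?n. (x i)\<^sup>2)"
  have N: "N > 0" using x(1) unfolding N_def by (metis finite_lessThan lessThan_iff sum_pos2 zero_le_power2 zero_less_power2)
  have wsym: "w i j = w j i" for i j using sym by (simp add: w_def)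
  have 1: "(r - c) * N = (\<Sum>i<?n. \<Sum>j<?n. w i j * (x i - x j) * x i)"
    unfolding N_def sum_distrib_left
    by (rule sum.cong) (auto simp: power2_eq_square sum_distrib_right[symmetric] x(2)[symmetric])
  \<comment> \<open>Exchanges \<open>i\<close> and \<open>j\<close> using the symmetry of
    \<open>w\<close>; adding both forms of the sum yields the squares in \<open>Q\<close>.\<close>
  have 2: "(r - c) * N = (\<Sum>i<?n. \<Sum>j<?n. w i j * (x j - x i) * x j)"
    unfolding 1 by (subst sum.swap) (simp add: wsym)
  have Q: "2 * (r - c) * N = (\<Sum>i<?n. \<Sum>j<?n. w i j * (x i - x j)\<^sup>2)"
  proof -
    have "2 * (r - c) * N = (\<Sum>i<?n. \<Sum>j<?n. w i j * (x i - x j) * x i) +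
        (\<Sum>i<?n. \<Sum>j<?n. w i j * (x j - x i) * x j)"
      unfolding 1[symmetric] 2[symmetric] by simp
    also have "\<dots> = (\<Sum>i<?n. \<Sum>j<?n. w i j * (x i - x j)\<^sup>2)"
      unfolding sum.distrib[symmetric]
      by (intro sum.cong) (auto simp: power2_eq_square algebra_simps)
    finally show ?thesis .
  qed
  have "2 * (r - c) * N \<ge> 0" unfolding Q by (intro sum_nonneg) (auto simp: w_def)
  then show "c \<le> r" using N by (simp add: zero_le_mult_iff)
  have "(\<Sum>i<?n. \<Sum>j<?n. w i j * (x i - x j)\<^sup>2) \<le> (\<Sum>i<?n. \<Sum>j<?n. (x i - x j)\<^sup>2)"
    by (intro sum_mono) (auto simp: w_def)
  also have "\<dots> = (\<Sum>i<?n. \<Sum>j<?n. (x i)\<^sup>2) + (\<Sum>i<?n. \<Sum>j<?n. (x j)\<^sup>2)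
      - 2 * (\<Sum>i<?n. \<Sum>j<?n. x i * x j)"
    unfolding sum_distrib_left sum.distrib[symmetric] sum_subtractf[symmetric]
    by (intro sum.cong) (auto simp: power2_eq_square algebra_simps)
  also have "(\<Sum>i<?n. \<Sum>j<?n. x i * x j) = (\<Sum>i<?n. x i)\<^sup>2"
    by (simp add: power2_eq_square sum_product)
  also have "(\<Sum>i<?n. \<Sum>j<?n. (x i)\<^sup>2) + (\<Sum>i<?n. \<Sum>j<?n. (x j)\<^sup>2)
      - 2 * (\<Sum>i<?n. x i)\<^sup>2 = 2 * real ?n * N - 2 * (\<Sum>i<?n. x i)\<^sup>2"
    by (simp add: N_def sum_distrib_left[symmetric])
  also have "\<dots> \<le> 2 * real ?n * N" by simp
  finally have "(2 * (r - c)) * N \<le> (2 * real ?n) * N" using Q by simp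
  then have "2 * (r - c) \<le> 2 * real ?n" using N by simp
  then show "r \<le> c + real ?n" by simp
qed

text \<open>No root lies below \<open>c\<close>, hence \<open>c - 1\<close> is not a root.
  Nonvanishing is what allows \<open>proots\<close> to turn products into sums of multisets.\<close>

lemma lap_poly_nonzero:
  assumes "\<And>u v. R u v \<longleftrightarrow> R v u"
  shows "lap_poly R vs c \<noteq> 0"
  using lap_poly_root_bounds(1)[of R vs c "c - 1"] assms by fastforce

section \<open>Spectra in the presence of dominating vertices\<close>

lemma sorted_list_of_multiset_nth_1:
  assumes "\<And>x. x \<in># M \<Longrightarrow> a \<le> x" and "M \<noteq> {#}"
  shows "sorted_list_of_multiset (add_mset a M) ! 1 \<in># M"
    and "y \<in># M \<Longrightarrow> sorted_list_of_multiset (add_mset a M) ! 1 \<le> y"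
proof -
  obtain b xs where bxs: "sorted_list_of_multiset M = b # xs"
    using assms(2) by (metis list.exhaust sorted_list_of_multiset_mset mset_sorted_list_of_multiset mset.simps(1))
  have set: "set_mset M = insert b (set xs)"
    by (metis bxs list.simps(15) set_sorted_list_of_multiset)
  have "a \<le> b" using assms(1) set by simp
  then have eq: "sorted_list_of_multiset (add_mset a M) ! 1 = b"
    by (simp add: bxs)
  have "sorted (b # xs)" using bxs by (metis sorted_sorted_list_of_multiset)
  then show "sorted_list_of_multiset (add_mset a M) ! 1 \<in># M"
    and "y \<in># M \<Longrightarrow> sorted_list_of_multiset (add_mset a M) ! 1 \<le> y"
    using set unfolding eq by auto
qed

text \<open>In the second use of \<open>lap_poly_Cons_dominating\<close> the list is one shorter and
  the shift one larger, so the root \<open>length vs\<close> appears again. The spare root 1 cancels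
  between the two identities, the spare root 2 against the constant eigenvector of
  \<open>us\<close>.\<close>

lemma proots_two_dominating:
  assumes sym: "\<And>u v. R u v \<longleftrightarrow> R v u" and vs: "vs = e # z # us" "us \<noteq> []"
    and irrefl: "\<not> R e e" "\<not> R z z"
    and dom: "\<And>v. v \<in> set (z # us) \<Longrightarrow> R e v" "\<And>v. v \<in> set us \<Longrightarrow> R z v"
  obtains N where "proots (lap_poly R vs 0) = {#0, real (length vs), real (length vs)#} + N"
    and "\<And>x. x \<in># N \<Longrightarrow> x \<ge> 2"
proof -
  let ?n = "real (length vs)"
  note nz = lap_poly_nonzero[of R, OF sym]
  let ?p = "lap_poly R vs 0" and ?q = "lap_poly R (z # us) 1" and ?r = "lap_poly R us 2"
  have "?p * [:-1, 1:] = [:0, 1:] * [:- ?n, 1:] * ?q"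
    using lap_poly_Cons_dominating[of R e "z # us" 0] irrefl dom sym vs by (simp add: algebra_simps)
  then have "proots (?p * [:-1, 1:]) = proots ([:0, 1:] * [:- ?n, 1:] * ?q)" by metis
  then have 1: "proots ?p + {#1#} = {#0#} + {#?n#} + proots ?q"
    using nz by (simp add: proots_mult del: mult_pCons_left mult_pCons_right)
  have "?q * [:-2, 1:] = [:-1, 1:] * [:- ?n, 1:] * ?r"
    using lap_poly_Cons_dominating[of R z us 1] irrefl dom sym vs by (simp add: algebra_simps)
  then have "proots (?q * [:-2, 1:]) = proots ([:-1, 1:] * [:- ?n, 1:] * ?r)" by metis
  then have 2: "proots ?q + {#2#} = {#1#} + {#?n#} + proots ?r"
    using nz by (simp add: proots_mult del: mult_pCons_left mult_pCons_right)
  have "2 \<in># proots ?r" using nz lap_poly_root_shift[OF vs(2)] by simp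
  then obtain N where N: "proots ?r = add_mset 2 N" by (metis insert_DiffM)
  have "proots ?q = {#1#} + {#?n#} + N" using 2 N by simp
  then have "proots ?p = {#0, ?n, ?n#} + N" using 1 by simp
  moreover have "x \<ge> 2" if "x \<in># N" for x
  proof -
    have "x \<in># proots ?r" using that N by simp
    then show ?thesis using lap_poly_root_bounds(1)[of R us 2 x] nz sym by simp
  qed
  ultimately show ?thesis using that by blast
qed

text \<open>A root of either part exceeds the size of that part by at most 1, which is below
  \<open>length vs\<close> because the other part is nonempty. Both parts have the root 1; one copy
  cancels the extra linear factor and the other survives.\<close>

lemma proots_cut_vertex:
  assumes sym: "\<And>u v. R u v \<longleftrightarrow> R v u" and vs: "vs = e # us @ ws" "us \<noteq> []" "ws \<noteq> []"
    and irrefl: "\<not> R e e" and dom: "\<And>v. v \<in> set (us @ ws) \<Longrightarrow> R e v"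
    and cut: "\<And>u w. u \<in> set us \<Longrightarrow> w \<in> set ws \<Longrightarrow> \<not> R u w"
  obtains N where "proots (lap_poly R vs 0) = {#0, real (length vs), 1#} + N"
    and "\<And>x. x \<in># N \<Longrightarrow> 1 \<le> x \<and> x < real (length vs)"
proof -
  let ?n = "real (length vs)"
  note nz = lap_poly_nonzero[of R, OF sym]
  let ?p = "lap_poly R vs 0" and ?q = "lap_poly R us 1" and ?r = "lap_poly R ws 1"
  have "lap_poly R (us @ ws) 1 = ?q * ?r"
    by (rule lap_poly_append) (use cut sym in blast)
  then have "?p * [:-1, 1:] = [:0, 1:] * [:- ?n, 1:] * (?q * ?r)"
    using lap_poly_Cons_dominating[of R e "us @ ws" 0] irrefl dom sym vs by (simp add: algebra_simps)
  then have "proots (?p * [:-1, 1:]) = proots ([:0, 1:] * [:- ?n, 1:] * (?q * ?r))" by metis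
  then have 1: "proots ?p + {#1#} = {#0#} + {#?n#} + (proots ?q + proots ?r)"
    using nz by (simp add: proots_mult del: mult_pCons_left mult_pCons_right)
  have "1 \<in># proots ?q" "1 \<in># proots ?r" using nz lap_poly_root_shift vs by simp_all
  then obtain N1 N2 where N: "proots ?q = add_mset 1 N1" "proots ?r = add_mset 1 N2"
    by (metis insert_DiffM)
  have "proots ?p = {#0, ?n, 1#} + (N1 + N2)" using 1 N by simp
  moreover have "1 \<le> x \<and> x < ?n" if "x \<in># N1 + N2" for x
  proof -
    have "x \<in># proots ?q \<or> x \<in># proots ?r" using that N by auto
    then have "1 \<le> x \<and> (x \<le> 1 + real (length us) \<or> x \<le> 1 + real (length ws))"
      using lap_poly_root_bounds[of R us 1 x] lap_poly_root_bounds[of R ws 1 x] nz sym by auto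
    moreover have "real (length us) > 0" "real (length ws) > 0" using vs by simp_all
    moreover have "?n = 1 + real (length us) + real (length ws)" using vs by simp
    ultimately show ?thesis by linarith
  qed
  ultimately show ?thesis using that by blast
qed

section \<open>Transfer from vertex lists to graphs\<close>

lemma (in pair_graph) laplacian_spectrum_eq:
  assumes "distinct vs" and "set vs = pverts G"
  shows "laplacian_spectrum G = proots (lap_poly (\<lambda>u v. (u, v) \<in> parcs G) vs 0)"
proof -
  let ?R = "\<lambda>u v. (u, v) \<in> parcs G"
  define ws where "ws = vertex_list G"
  have ws: "distinct ws" "set ws = pverts G"
    using someI_ex[of "\<lambda>vs. distinct vs \<and> set vs = pverts G"] finite_distinct_list[OF finite_verts]
    unfolding ws_def vertex_list_def by auto
  have deg: "real (out_degree (with_proj G) v) = list_degree ?R ws v" if "v \<in> pverts G" for v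
  proof -
    have "out_arcs (with_proj G) v = Pair v ` {w \<in> set ws. ?R v w}"
      using in_arcsD2 by (auto simp: out_arcs_def ws)
    then have "out_degree (with_proj G) v = card {w \<in> set ws. ?R v w}"
      unfolding out_degree_def by (simp add: card_image inj_on_def)
    then show ?thesis using ws(1) by (simp add: list_degree_conv_sum of_bool_def sum.If_cases Int_def)
  qed
  have "(v, v) \<notin> parcs G" for v using no_loops[of "(v, v)"] by auto
  then have "char_poly_matrix (laplacian_mat G) = lap_charmat ?R ws 0"
    by (intro eq_matI) (auto simp: char_poly_matrix_def laplacian_mat_def degree_mat_def
      adjacency_mat_def Let_def lap_charmat_def ws_def[symmetric] deg ws(2)[symmetric] one_pCons)
  then have "laplacian_spectrum G = proots (lap_poly ?R ws 0)"
    by (simp add: laplacian_spectrum_def char_poly_def lap_poly_def)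
  also have "lap_poly ?R ws 0 = lap_poly ?R vs 0"
    using assms ws by (intro lap_poly_eqI_set) auto
  finally show ?thesis .
qed

lemma (in pair_graph) two_dominating_vertices:
  assumes verts: "e \<in> pverts G" "z \<in> pverts G" "e \<noteq> z" "card (pverts G) \<ge> 3"
    and dom: "\<And>v. v \<in> pverts G \<Longrightarrow> v \<noteq> e \<Longrightarrow> (e, v) \<in> parcs G"
      "\<And>v. v \<in> pverts G \<Longrightarrow> v \<noteq> z \<Longrightarrow> (z, v) \<in> parcs G"
  shows "laplacian_multiplicity G (real (card (pverts G))) \<noteq> 1" "algebraic_connectivity G \<noteq> 1"
proof -
  let ?R = "\<lambda>u v. (u, v) \<in> parcs G" and ?n = "real (card (pverts G))"
  obtain us where us: "distinct us" "set us = pverts G - {e, z}"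
    using finite_distinct_list[of "pverts G - {e, z}"] by auto
  define vs where "vs = e # z # us"
  have vs: "distinct vs" "set vs = pverts G" using us verts by (auto simp: vs_def)
  then have len: "length vs = card (pverts G)" by (metis distinct_card)
  \<comment> \<open>A third vertex is essential: on two adjacent vertices both dominate, yet the
    spectrum is {0, 2} with 2 simple.\<close>
  have ne: "us \<noteq> []" using len verts by (auto simp: vs_def)
  have sym: "?R u v \<longleftrightarrow> ?R v u" for u v using arcs_symmetric by blast
  have irr: "\<not> ?R v v" for v using no_loops[of "(v, v)"] by auto
  obtain N where N: "laplacian_spectrum G = {#0, ?n, ?n#} + N" "\<And>x. x \<in># N \<Longrightarrow> x \<ge> 2"
    using proots_two_dominating[of ?R vs e z us, OF sym vs_def ne irr irr] us verts dom
    unfolding laplacian_spectrum_eq[OF vs] len by auto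
  show "laplacian_multiplicity G ?n \<noteq> 1" unfolding laplacian_multiplicity_def N(1) by simp
  let ?M = "{#?n, ?n#} + N"
  have M: "laplacian_spectrum G = add_mset 0 ?M" using N(1) by simp
  have ge2: "2 \<le> x" if "x \<in># ?M" for x using that N(2) verts(4) by auto
  have ge: "0 \<le> x" if "x \<in># ?M" for x using ge2[OF that] by simp
  have ne: "?M \<noteq> {#}" by simp
  have "algebraic_connectivity G \<ge> 2"
    unfolding algebraic_connectivity_def M
    by (rule ge2, rule sorted_list_of_multiset_nth_1(1)[OF ge ne])
  then show "algebraic_connectivity G \<noteq> 1" by simp
qed

lemma (in pair_graph) dominating_cut_vertex:
  assumes verts: "pverts G = insert e (U \<union> W)" "e \<notin> U" "e \<notin> W" "U \<inter> W = {}" "U \<noteq> {}" "W \<noteq> {}"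
    and dom: "\<And>v. v \<in> U \<union> W \<Longrightarrow> (e, v) \<in> parcs G"
    and cut: "\<And>u w. u \<in> U \<Longrightarrow> w \<in> W \<Longrightarrow> (u, w) \<notin> parcs G"
  shows "laplacian_multiplicity G (real (card (pverts G))) = 1" "algebraic_connectivity G = 1"
proof -
  let ?R = "\<lambda>u v. (u, v) \<in> parcs G" and ?n = "real (card (pverts G))"
  have fin: "finite U" "finite W" using finite_verts verts(1) by auto
  obtain us ws where us: "distinct us" "set us = U" and ws: "distinct ws" "set ws = W"
    using finite_distinct_list[OF fin(1)] finite_distinct_list[OF fin(2)] by auto
  define vs where "vs = e # us @ ws"
  have vs: "distinct vs" "set vs = pverts G" using us ws verts by (auto simp: vs_def)
  then have len: "length vs = card (pverts G)" by (metis distinct_card)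
  have ne: "us \<noteq> []" "ws \<noteq> []" using us ws verts by auto
  have sym: "?R u v \<longleftrightarrow> ?R v u" for u v using arcs_symmetric by blast
  have irr: "\<not> ?R v v" for v using no_loops[of "(v, v)"] by auto
  obtain N where N: "laplacian_spectrum G = {#0, ?n, 1#} + N" "\<And>x. x \<in># N \<Longrightarrow> 1 \<le> x \<and> x < ?n"
    using proots_cut_vertex[of ?R vs e us ws, OF sym vs_def ne irr] us ws dom cut
    unfolding laplacian_spectrum_eq[OF vs] len by auto
  have "length us > 0" "length ws > 0" using ne by simp_all
  \<comment> \<open>Keeps \<open>?n\<close> apart from the eigenvalues 0 and 1, so that neither adds
    to its multiplicity.\<close>
  then have n: "?n \<ge> 3" unfolding len[symmetric] vs_def length_Cons length_append by linarith
  have "count N ?n = 0" using N(2)[of ?n] by (auto simp: count_eq_zero_iff)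
  then show "laplacian_multiplicity G ?n = 1"
    unfolding laplacian_multiplicity_def N(1) using n verts(1) by auto
  let ?M = "{#?n, 1#} + N"
  have M: "laplacian_spectrum G = add_mset 0 ?M" using N(1) by simp
  have ge1: "1 \<le> x" if "x \<in># ?M" for x using that N(2) n by auto
  have ge: "0 \<le> x" if "x \<in># ?M" for x using ge1[OF that] by simp
  have ne: "?M \<noteq> {#}" by simp
  have "algebraic_connectivity G \<in># ?M" "algebraic_connectivity G \<le> 1"
    unfolding algebraic_connectivity_def M
    using sorted_list_of_multiset_nth_1[OF ge ne] by simp_all
  then show "algebraic_connectivity G = 1" using ge1 by fastforce
qed

section \<open>Finite p-groups with a unique subgroup of order p\<close>

text \<open>Cauchy's theorem: Sylow provides a subgroup of order \<open>q\<close>, and each of its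
  nontrivial elements has order \<open>q\<close>.\<close>

lemma (in group) exists_ord_prime:
  assumes "finite (carrier G)" "prime q" "q dvd Coset.order G"
  shows "\<exists>x\<in>carrier G. ord x = q"
proof -
  obtain m where "Coset.order G = q ^ 1 * m" using assms(3) by auto
  then obtain H where H: "subgroup H G" "card H = q"
    using sylow_thm[OF assms(2) is_group _ assms(1), of 1] by auto
  then have "H \<noteq> {\<one>}" using assms(2) prime_gt_1_nat by fastforce
  then obtain x where x: "x \<in> H" "x \<noteq> \<one>" using subgroup.one_closed[OF H(1)] by blast
  then have xG: "x \<in> carrier G" using subgroup.mem_carrier[OF H(1)] by blast
  have "x [^]\<^bsub>G\<lparr>carrier := H\<rparr>\<^esub> q = \<one>"
    using group.pow_order_eq_1[OF subgroup.subgroup_is_group[OF H(1) is_group], of x] x H(2)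
    unfolding Coset.order_def by simp
  then have "x [^] q = \<one>" by (metis nat_pow_consistent)
  then have "ord x dvd q" using pow_eq_id xG by blast
  moreover have "ord x \<noteq> 1" using x xG ord_eq_1 by blast
  ultimately show ?thesis using assms(2) xG prime_nat_iff by blast
qed

lemma prime_dvd_of_dvd_prime_power:
  fixes p :: nat
  assumes "prime p" "d dvd p ^ m" "d \<noteq> 1"
  shows "p dvd d"
proof -
  obtain i where "d = p ^ i" using assms divides_primepow_nat by blast
  with assms(3) show ?thesis by (cases i) auto
qed

text \<open>\<open>p_group\<close> speaks only of orders of elements. By Cauchy's theorem a prime
  divisor of the group order is the order of an element, hence equals \<open>p\<close>.\<close>

lemma p_group_order_prime_power:
  assumes "p_group p G" "finite (carrier G)"
  obtains m where "Coset.order G = p ^ m"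
proof -
  interpret group G using assms(1) by (simp add: p_group_def)
  have p: "prime p" using assms(1) by (simp add: p_group_def)
  have q: "q = p" if qd: "prime q" "q dvd Coset.order G" for q
  proof -
    obtain x k where "x \<in> carrier G" "ord x = q" "ord x = p ^ k"
      using exists_ord_prime[OF _ qd] assms by (auto simp: p_group_def)
    then have "q dvd p ^ k" by simp
    then show ?thesis using qd(1) p prime_dvd_power primes_dvd_imp_eq by blast
  qed
  have "Coset.order G \<noteq> 0" using order_gt_0_iff_finite assms(2) by simp
  then obtain m where m: "Coset.order G = p ^ multiplicity p (Coset.order G) * m" "\<not> p dvd m"
    using multiplicity_decompose'[of "Coset.order G" p] p
    by (metis not_prime_unit)
  have "m = 1"
  proof (rule ccontr)
    assume "m \<noteq> 1"
    then obtain q where "prime q" "q dvd m" using prime_factor_nat by blast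
    then show False using q m by (metis dvd_mult)
  qed
  then show ?thesis using m that by simp
qed

text \<open>The subgroup \<open>H\<close> acts by conjugation on the set of its conjugates. The latter has \<open>p\<close>-power
  cardinality and \<open>H\<close> itself is fixed, so a second conjugate is fixed as well.\<close>

lemma (in group) normalizer_grows:
  assumes fin: "finite (carrier G)" and p: "prime p" "Coset.order G = p ^ m"
    and H: "subgroup H G" "H \<noteq> carrier G"
  obtains g where "g \<in> carrier G" "g \<notin> H" "\<And>h. h \<in> H \<Longrightarrow> g \<otimes> h \<otimes> inv g \<in> H"
proof -
  define \<phi> where "\<phi> = (\<lambda>g. \<lambda>K\<in>{K. subgroup K G}. g <# K #> inv g)"
  have mem: "\<phi> g K = (\<lambda>h. g \<otimes> h \<otimes> inv g) ` K" if "subgroup K G" for g K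
    using that by (auto simp: \<phi>_def l_coset_def r_coset_def)
  interpret act: group_action G "{K. subgroup K G}" \<phi>
    unfolding \<phi>_def by (rule action_by_conjugation_on_subgroups_set)
  interpret actH: group_action "G\<lparr>carrier := H\<rparr>" "{K. subgroup K G}" \<phi>
    by (rule act.induced_action[OF H(1)])
  let ?\<Omega> = "orbit G \<phi> H"
  have HS: "H \<in> {K. subgroup K G}" using H by simp
  have HC: "H \<subseteq> carrier G" using H subgroup.subset by blast
  have fin\<Omega>: "finite ?\<Omega>" unfolding orbit_def using fin by simp
  have dvdH: "Coset.order (G\<lparr>carrier := H\<rparr>) dvd p ^ m"
  proof -
    have "Coset.order (G\<lparr>carrier := H\<rparr>) = card H" by (simp add: Coset.order_def)
    then show ?thesis using lagrange[OF H(1)] p by (metis dvd_triv_right)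
  qed
  show ?thesis
  proof (cases "card ?\<Omega> = 1")
    \<comment> \<open>Here \<open>H\<close> is normal, and every element outside of it will
      do.\<close>
    case True
    moreover have "H \<in> ?\<Omega>" using act.orbit_refl[OF HS] .
    ultimately have \<Omega>: "?\<Omega> = {H}" by (metis card_1_singletonE singletonD)
    obtain g where g: "g \<in> carrier G" "g \<notin> H" using H HC by blast
    then have "\<phi> g H = H" using \<Omega> unfolding orbit_def by blast
    then have "g \<otimes> h \<otimes> inv g \<in> H" if "h \<in> H" for h
      using mem[OF H(1)] that by blast
    then show ?thesis using that g by blast
  next
    case False
    have "card ?\<Omega> dvd p ^ m" using act.orbit_stabilizer_theorem[OF HS] p by (metis dvd_triv_left)
    then have p\<Omega>: "p dvd card ?\<Omega>" using False p(1) prime_dvd_of_dvd_prime_power by blast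
    \<comment> \<open>The orbits of \<open>H\<close> on the conjugates other than \<open>H\<close>.
      They partition a set of size \<open>card ?\<Omega> - 1\<close>, which \<open>p\<close> does
      not divide, so some orbit has size prime to \<open>p\<close>, that is, size 1.\<close>
    define C where "C = (\<lambda>K. orbit (G\<lparr>carrier := H\<rparr>) \<phi> K) ` (?\<Omega> - {H})"
    have sub: "K \<in> {K. subgroup K G}" if "K \<in> ?\<Omega>" for K
      using that act.element_image[OF _ HS] unfolding orbit_def by blast
    have fixH: "\<phi> h H = H" if "h \<in> H" for h
    proof -
      have "\<phi> h H \<subseteq> H" using that H(1) mem[OF H(1)]
        by (auto intro!: subgroup.m_closed[OF H(1)] subgroup.m_inv_closed[OF H(1)])
      moreover have "card (\<phi> h H) = card H"
        unfolding mem[OF H(1)] using that HC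
        by (intro card_image inj_onI) (simp add: subset_eq)
      ultimately show ?thesis using card_subset_eq finite_subset[OF HC fin] by blast
    qed
    have UC: "\<Union>C = ?\<Omega> - {H}"
    proof
      show "\<Union>C \<subseteq> ?\<Omega> - {H}"
      proof
        fix L assume "L \<in> \<Union>C"
        then obtain K where K: "K \<in> ?\<Omega>" "K \<noteq> H" "L \<in> orbit (G\<lparr>carrier := H\<rparr>) \<phi> K" by (auto simp: C_def)
        then obtain h where h: "h \<in> H" "L = \<phi> h K" by (auto simp: orbit_def)
        obtain x where x: "x \<in> carrier G" "K = \<phi> x H" using K by (auto simp: orbit_def)
        have "L = \<phi> (h \<otimes> x) H" using act.composition_rule[OF HS, of h x] h x HC by auto
        then have "L \<in> ?\<Omega>" using h x HC by (auto simp: orbit_def)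
        moreover have "L \<noteq> H"
        proof
          assume "L = H"
          then have "K \<in> orbit (G\<lparr>carrier := H\<rparr>) \<phi> H"
            using actH.orbit_sym[OF sub[OF K(1)] HS] K(3) by simp
          then show False using K(2) fixH by (auto simp: orbit_def)
        qed
        ultimately show "L \<in> ?\<Omega> - {H}" by simp
      qed
      show "?\<Omega> - {H} \<subseteq> \<Union>C" using actH.orbit_refl sub by (auto simp: C_def)
    qed
    have disj: "c1 \<inter> c2 = {}" if "c1 \<in> C" "c2 \<in> C" "c1 \<noteq> c2" for c1 c2
    proof -
      have "c1 \<in> orbits (G\<lparr>carrier := H\<rparr>) {K. subgroup K G} \<phi>" "c2 \<in> orbits (G\<lparr>carrier := H\<rparr>) {K. subgroup K G} \<phi>"
        using that sub by (auto simp: C_def orbits_def)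
      then show ?thesis using actH.disjoint_union that(3) by blast
    qed
    have "\<exists>K\<in>?\<Omega> - {H}. \<not> p dvd card (orbit (G\<lparr>carrier := H\<rparr>) \<phi> K)"
    proof (rule ccontr)
      assume "\<not> ?thesis"
      then have "\<forall>c\<in>C. p dvd card c" unfolding C_def by blast
      moreover have "finite (\<Union>C)" unfolding UC using fin\<Omega> by simp
      ultimately have "p dvd card (\<Union>C)" using disj by (intro dvd_partition) auto
      then have "p dvd card ?\<Omega> - 1"
        unfolding UC using act.orbit_refl[OF HS] fin\<Omega> by simp
      moreover have "card ?\<Omega> > 0" using act.orbit_refl[OF HS] fin\<Omega> card_gt_0_iff by blast
      ultimately have "p dvd card ?\<Omega> - (card ?\<Omega> - 1)" using p\<Omega> dvd_diff_nat by blast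
      with \<open>card ?\<Omega> > 0\<close> have "p dvd 1" by simp
      then show False using p(1) by simp
    qed
    then obtain K where K: "K \<in> ?\<Omega>" "K \<noteq> H" "\<not> p dvd card (orbit (G\<lparr>carrier := H\<rparr>) \<phi> K)" by blast
    have "card (orbit (G\<lparr>carrier := H\<rparr>) \<phi> K) dvd p ^ m"
      using actH.orbit_stabilizer_theorem[OF sub[OF K(1)]] dvdH by (metis dvd_triv_left dvd_trans)
    then have "card (orbit (G\<lparr>carrier := H\<rparr>) \<phi> K) = 1"
      using K(3) p(1) prime_dvd_of_dvd_prime_power by blast
    then have orbK: "orbit (G\<lparr>carrier := H\<rparr>) \<phi> K = {K}"
      using actH.orbit_refl[OF sub[OF K(1)]] by (metis card_1_singletonE singletonD)
    then have fixK: "\<phi> h K = K" if "h \<in> H" for h using that by (auto simp: orbit_def)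
    obtain x where x: "x \<in> carrier G" "K = \<phi> x H" using K by (auto simp: orbit_def)
    have ix: "\<phi> (inv x) K = H" using act.orbit_sym_aux[OF x(1) HS] x(2) by simp
    \<comment> \<open>As \<open>H\<close> fixes \<open>K = x H x^-1\<close>, all of
      \<open>x^-1 H x\<close> normalizes \<open>H\<close>. It is not contained in \<open>H\<close>,
      since equal cardinality would then force \<open>K = H\<close>.\<close>
    have norm: "\<phi> (inv x \<otimes> h \<otimes> x) H = H" if "h \<in> H" for h
      using that HC x ix fixK[OF that] act.composition_rule[OF HS, of "inv x \<otimes> h" x]
        act.composition_rule[OF sub[OF K(1)], of "inv x" h] by auto
    have "\<exists>h\<in>H. inv x \<otimes> h \<otimes> x \<notin> H"
    proof (rule ccontr)
      assume "\<not> ?thesis"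
      then have "\<phi> (inv x) H \<subseteq> H" using mem[OF H(1)] x(1) by auto
      moreover have "card (\<phi> (inv x) H) = card H"
        unfolding mem[OF H(1)] using x(1) HC
        by (intro card_image inj_onI) (simp add: subset_eq)
      ultimately have "\<phi> (inv x) H = H" using card_subset_eq finite_subset[OF HC fin] by blast
      then have "\<phi> (inv (inv x)) H = H" using act.orbit_sym_aux[OF inv_closed[OF x(1)] HS] by simp
      then show False using x K(2) by simp
    qed
    then obtain h where h: "h \<in> H" "inv x \<otimes> h \<otimes> x \<notin> H" by blast
    show ?thesis
    proof (rule that[of "inv x \<otimes> h \<otimes> x"])
      fix y assume "y \<in> H"
      then show "inv x \<otimes> h \<otimes> x \<otimes> y \<otimes> inv (inv x \<otimes> h \<otimes> x) \<in> H"
        using norm[OF h(1)] unfolding mem[OF H(1)] by blast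
    qed (use h x HC in auto)
  qed
qed

text \<open>For odd \<open>p\<close> and \<open>r = 1 + p u\<close>, the sum is
  \<open>p + p u p (p - 1) / 2\<close> modulo \<open>p^2\<close>, and oddness makes the second term
  vanish. For \<open>p = 2\<close> the sum is \<open>1 + r\<close>, twice an odd number exactly for
  \<open>r = 1\<close> modulo 4; the residue 3 left out is the one realized by quaternion
  groups.\<close>

lemma sum_powers_prime:
  fixes r :: nat
  assumes "prime p" and "odd p \<and> [r = 1] (mod p) \<or> p = 2 \<and> [r = 1] (mod 4)"
  obtains w where "(\<Sum>i<p. r ^ i) = p * w" "coprime w p"
  using assms(2)
proof
  assume *: "odd p \<and> [r = 1] (mod p)"
  have p: "p > 1" using assms(1) prime_gt_1_nat by blast
  have "r mod p = 1" using * p by (simp add: cong_def)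
  then obtain u where r: "r = 1 + p * u" by (metis add.commute mult_div_mod_eq)
  have c: "[r ^ i = 1 + p * u * i] (mod p\<^sup>2)" for i
  proof (induction i)
    case (Suc i)
    have "[r ^ Suc i = r * (1 + p * u * i)] (mod p\<^sup>2)"
      using cong_mult[OF cong_refl Suc] by simp
    also have "r * (1 + p * u * i) = 1 + p * u * Suc i + p\<^sup>2 * (u * u * i)"
      by (simp add: r power2_eq_square algebra_simps)
    also have "[\<dots> = 1 + p * u * Suc i] (mod p\<^sup>2)" by (simp add: cong_def)
    finally show ?case .
  qed simp
  have "[(\<Sum>i<p. r ^ i) = (\<Sum>i<p. 1 + p * u * i)] (mod p\<^sup>2)"
    using c by (intro cong_sum)
  also have "(\<Sum>i<p. 1 + p * u * i) = p + p * u * (\<Sum>i<p. i)"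
    by (simp only: sum.distrib sum_distrib_left) simp
  also have "(\<Sum>i<p. i) = p * ((p - 1) div 2)"
  proof -
    have "(\<Sum>i<2 * k + 1. i) = (2 * k + 1) * k" for k :: nat
      by (induction k) auto
    moreover obtain k where "p = 2 * k + 1" using * oddE by blast
    ultimately show ?thesis by simp
  qed
  also have "p + p * u * (p * ((p - 1) div 2)) = p + p\<^sup>2 * (u * ((p - 1) div 2))"
    by (simp add: power2_eq_square)
  also have "[\<dots> = p] (mod p\<^sup>2)" by (simp add: cong_def)
  finally have S: "[(\<Sum>i<p. r ^ i) = p] (mod p * p)" by (simp add: power2_eq_square)
  then have "[(\<Sum>i<p. r ^ i) = p] (mod p)" by (rule cong_modulus_mult_nat)
  then have "p dvd (\<Sum>i<p. r ^ i)" by (simp add: cong_dvd_iff)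
  then obtain w where w: "(\<Sum>i<p. r ^ i) = p * w" by blast
  have "[p * w = p * 1] (mod p * p)" using S w by simp
  then have "[w = 1] (mod p)" using p by (simp add: cong_def mult_mod_right[symmetric])
  then have "coprime w p" using cong_imp_coprime cong_sym coprime_1_left by blast
  then show ?thesis using w that by blast
next
  assume *: "p = 2 \<and> [r = 1] (mod 4)"
  then have "r mod 4 = 1" by (simp add: cong_def)
  then obtain q where "r = 4 * q + 1" by (metis mult_div_mod_eq)
  then have "(\<Sum>i<p. r ^ i) = p * (2 * q + 1)" "coprime (2 * q + 1) p"
    using * by (simp_all add: lessThan_Suc numeral_2_eq_2[THEN arg_cong[of _ _ lessThan]])
  then show ?thesis using that by blast
qed

section \<open>Computing with a cyclic subgroup and an element normalizing it\<close>

lemma (in group) nat_pow_eq_iff: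
  "a \<in> carrier G \<Longrightarrow> a [^] (i::nat) = a [^] (j::nat) \<longleftrightarrow> [i = j] (mod ord a)"
  using int_pow_eq[of a "int j" "int i"]
  by (auto simp: int_pow_int cong_int_iff[symmetric] cong_iff_dvd_diff)

lemma (in group) mem_generate_singleton_iff:
  assumes "finite (carrier G)" "a \<in> carrier G"
  shows "x \<in> generate G {a} \<longleftrightarrow> (\<exists>k::nat. x = a [^] k)"
proof -
  have "ord a \<noteq> 0" using ord_ge_1[OF assms] by simp
  then show ?thesis using generate_pow_nat[OF assms(2)] by auto
qed

text \<open>Moving every \<open>a\<close> in \<open>(a^j x)^m\<close> to the left takes the factor
  \<open>a^j\<close> past \<open>i\<close> copies of \<open>x\<close> for each \<open>i < m\<close>,
  which contributes \<open>j r^i\<close> to the exponent.\<close>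

lemma (in group)
  fixes r j m :: nat
  assumes [simp]: "a \<in> carrier G" "x \<in> carrier G" and twist: "x \<otimes> a = a [^] r \<otimes> x"
  shows twist_nat_pow: "x [^] m \<otimes> a [^] j = a [^] (r ^ m * j) \<otimes> x [^] m"
    and nat_pow_twisted_mult: "(a [^] j \<otimes> x) [^] m = a [^] (j * (\<Sum>i<m. r ^ i)) \<otimes> x [^] m"
proof -
  have 1: "x \<otimes> a [^] j = a [^] (r * j) \<otimes> x" for j
  proof (induction j)
    case (Suc j)
    have "x \<otimes> a [^] Suc j = (x \<otimes> a [^] j) \<otimes> a" by (simp add: m_assoc)
    also have "\<dots> = a [^] (r * j) \<otimes> (x \<otimes> a)" by (simp add: Suc m_assoc)
    also have "\<dots> = (a [^] (r * j) \<otimes> a [^] r) \<otimes> x" by (simp add: twist m_assoc)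
    also have "\<dots> = a [^] (r * Suc j) \<otimes> x" by (simp add: nat_pow_mult add.commute)
    finally show ?case .
  qed simp
  have 2: "x [^] m \<otimes> a [^] j = a [^] (r ^ m * j) \<otimes> x [^] m" for m j :: nat
  proof (induction m arbitrary: j)
    case (Suc m)
    have "x [^] Suc m \<otimes> a [^] j = x [^] m \<otimes> (x \<otimes> a [^] j)" by (simp add: m_assoc)
    also have "\<dots> = (x [^] m \<otimes> a [^] (r * j)) \<otimes> x" by (simp add: 1 m_assoc)
    also have "\<dots> = a [^] (r ^ m * (r * j)) \<otimes> x [^] m \<otimes> x" by (simp only: Suc)
    also have "\<dots> = a [^] (r ^ Suc m * j) \<otimes> x [^] Suc m" by (simp add: m_assoc mult_ac)
    finally show ?case .
  qed simp
  show "x [^] m \<otimes> a [^] j = a [^] (r ^ m * j) \<otimes> x [^] m" by (rule 2)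
  show "(a [^] j \<otimes> x) [^] m = a [^] (j * (\<Sum>i<m. r ^ i)) \<otimes> x [^] m"
  proof (induction m)
    case (Suc m)
    have "(a [^] j \<otimes> x) [^] Suc m = a [^] (j * (\<Sum>i<m. r ^ i)) \<otimes> (x [^] m \<otimes> a [^] j) \<otimes> x"
      by (simp add: Suc m_assoc)
    also have "\<dots> = (a [^] (j * (\<Sum>i<m. r ^ i)) \<otimes> a [^] (r ^ m * j)) \<otimes> x [^] Suc m"
      by (simp only: 2) (simp add: m_assoc)
    also have "\<dots> = a [^] (j * (\<Sum>i<Suc m. r ^ i)) \<otimes> x [^] Suc m"
      by (simp add: nat_pow_mult algebra_simps)
    finally show ?case .
  qed simp
qed

text \<open>The witness is \<open>- t\<close> times the inverse of \<open>w\<close>; over the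
  naturals \<open>n - 1\<close> stands for -1.\<close>

lemma cong_solve_additive:
  fixes w t n :: nat
  assumes "coprime w n" "n > 0"
  obtains j where "n dvd j * w + t"
proof -
  obtain y where y: "[w * y = 1] (mod n)" using cong_solve_coprime_nat[OF assms(1)] by auto
  have "[y * (n - 1) * t * w + t = 1 * ((n - 1) * t) + t] (mod n)"
    using cong_add[OF cong_mult[OF y cong_refl[of "(n - 1) * t"]] cong_refl[of t]]
    by (simp add: mult_ac)
  also have "1 * ((n - 1) * t) + t = n * t" using assms(2) by (cases n) auto
  finally have "n dvd y * (n - 1) * t * w + t" using cong_dvd_iff by fastforce
  then show ?thesis using that by blast
qed

text \<open>With \<open>x a x\<^sup>-\<^sup>1 = a\<^sup>r\<close> and \<open>x\<^sup>p = a\<^sup>p\<^sup>t\<close> one has \<open>(a\<^sup>j x)\<^sup>p = a\<^sup>j\<^sup>S\<^sup>+\<^sup>p\<^sup>t\<close> for \<open>S = 1 + r + \<dots> + r\<^sup>p\<^sup>-\<^sup>1\<close>. If \<open>S\<close> is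
  \<open>p\<close> times a unit then \<open>j\<close> can be chosen to make this trivial, contradicting \<open>none\<close>.\<close>

lemma (in group) cyclic_p_subgroup_extension:
  assumes fin: "finite (carrier G)" and p: "prime p"
    and a: "a \<in> carrier G" "ord a = p ^ k" "k \<ge> 1"
    and x: "x \<in> carrier G" "x \<notin> generate G {a}" "x [^] p \<in> generate G {a}"
      "x \<otimes> a \<otimes> inv x \<in> generate G {a}" "ord x \<le> ord a"
    and none: "\<And>y. y \<in> carrier G \<Longrightarrow> y \<notin> generate G {a} \<Longrightarrow> y [^] p \<noteq> \<one>"
  shows "p = 2" "k \<ge> 2" "x \<otimes> a \<otimes> inv x = inv a" "x [^] (2::nat) = a [^] (2 ^ (k - 1) :: nat)"
proof -
  note mem = mem_generate_singleton_iff[OF fin a(1)]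
  note [simp] = a(1) x(1)
  have p1: "p > 1" using p prime_gt_1_nat by blast
  obtain r0 :: nat where r0: "x \<otimes> a \<otimes> inv x = a [^] r0" using x(4) mem by blast
  \<comment> \<open>Reduced below \<open>p ^ k\<close>, so that \<open>r = 3\<close> modulo 4
    excludes \<open>k = 1\<close> once \<open>p = 2\<close> is known.\<close>
  define r where "r = r0 mod p ^ k"
  have rlt: "r < p ^ k" using p1 by (simp add: r_def)
  have conj: "x \<otimes> a \<otimes> inv x = a [^] r"
    unfolding r0 by (simp add: nat_pow_eq_iff a(2) r_def cong_def)
  have twist: "x \<otimes> a = a [^] r \<otimes> x"
    using conj by (metis a(1) inv_closed inv_solve_right' m_closed nat_pow_closed x(1))
  obtain s :: nat where s: "x [^] p = a [^] s" using x(3) mem by blast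
  \<comment> \<open>Otherwise \<open>x [^] p\<close> has order \<open>p ^ k\<close>. If
    \<open>p\<close> divides \<open>ord x\<close>, then \<open>x\<close> has larger order than
    \<open>a\<close>; if not, \<open>ord x\<close> is itself \<open>p ^ k\<close>, which
    \<open>p\<close> does divide.\<close>
  have ps: "p dvd s"
  proof (rule ccontr)
    assume "\<not> p dvd s"
    then have "coprime (p ^ k) s" using p by (simp add: prime_imp_coprime)
    moreover have "s \<noteq> 0" using \<open>\<not> p dvd s\<close> by (metis dvd_0_right)
    ultimately have "ord (x [^] p) = p ^ k" unfolding s by (simp add: ord_pow_gen a(2))
    then have e: "ord x div gcd (ord x) p = p ^ k" using p1 by (simp add: ord_pow_gen)
    show False
    proof (cases "p dvd ord x")
      case True
      then have "ord x div p = p ^ k" using e by (simp add: gcd_proj2_if_dvd_nat)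
      then have "ord x = p * p ^ k" using True by (metis dvd_mult_div_cancel)
      then show False using x(5) a(2) p1 by simp
    next
      case False
      then have "gcd (ord x) p = 1"
        using p by (metis coprime_commute coprime_iff_gcd_eq_1 prime_imp_coprime)
      then have "ord x = p ^ k" using e by simp
      then show False using False a(3) by simp
    qed
  qed
  then obtain t where t: "s = p * t" by blast
  have coset: "a [^] j \<otimes> x \<notin> generate G {a}" for j :: nat
  proof
    assume "a [^] j \<otimes> x \<in> generate G {a}"
    moreover have "a [^] j \<in> generate G {a}" using mem by blast
    ultimately have "inv (a [^] j) \<otimes> (a [^] j \<otimes> x) \<in> generate G {a}"
      using generate_is_subgroup[of "{a}"] by (simp add: subgroup.m_closed subgroup.m_inv_closed)
    then show False using x(2) by (simp add: m_assoc[symmetric])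
  qed
  have bad: "\<not> (odd p \<and> [r = 1] (mod p) \<or> p = 2 \<and> [r = 1] (mod 4))"
  proof
    assume "odd p \<and> [r = 1] (mod p) \<or> p = 2 \<and> [r = 1] (mod 4)"
    then obtain w where w: "(\<Sum>i<p. r ^ i) = p * w" "coprime w p"
      using sum_powers_prime[OF p] by blast
    then obtain j where j: "p ^ k dvd j * w + t"
      using cong_solve_additive[of w "p ^ k"] p1 by auto
    have "(a [^] j \<otimes> x) [^] p = a [^] (j * (p * w)) \<otimes> a [^] (p * t)"
      using nat_pow_twisted_mult[OF a(1) x(1) twist] by (simp add: w s t)
    also have "\<dots> = a [^] (p * (j * w + t))" by (simp add: nat_pow_mult algebra_simps)
    also have "\<dots> = \<one>" using j by (simp add: pow_eq_id a(2))
    finally show False using none[OF _ coset[of j]] by simp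
  qed
  \<comment> \<open>As a power of \<open>a\<close>, \<open>x [^] p\<close> commutes with
    \<open>a\<close>, so \<open>r ^ p = 1\<close> modulo \<open>p ^ k\<close>. By Fermat
    \<open>r = 1\<close> modulo \<open>p\<close>, and then \<open>bad\<close> leaves only
    \<open>p = 2\<close> with \<open>r = 3\<close> modulo 4.\<close>
  have "a [^] (r ^ p) \<otimes> x [^] p = x [^] p \<otimes> a"
    using twist_nat_pow[OF a(1) x(1) twist, of p 1] by simp
  also have "\<dots> = a \<otimes> x [^] p" unfolding s by (metis a(1) nat_pow_Suc nat_pow_Suc2)
  finally have "a [^] (r ^ p) = a [^] (1::nat)" by simp
  then have rp: "[r ^ p = 1] (mod p ^ k)" by (simp only: nat_pow_eq_iff[OF a(1)] a(2))
  then have rp1: "[r ^ p = 1] (mod p)" using a(3)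
    by (metis cong_dvd_modulus_nat dvd_power less_eq_Suc_le One_nat_def)
  have "\<not> p dvd r"
  proof
    assume "p dvd r"
    then have "p dvd r ^ p" using p1 by (simp add: dvd_power_le dvd_trans[OF _ dvd_power])
    then show False using rp1 p1 cong_dvd_iff by fastforce
  qed
  then have "[r * r ^ (p - 1) = r * 1] (mod p)" using fermat_theorem[OF p] cong_scalar_left by blast
  then have "[r ^ p = r] (mod p)" using p1 by (simp add: power_eq_if)
  then have r1: "[r = 1] (mod p)" using rp1 cong_sym cong_trans by blast
  show p2: "p = 2" using bad r1 p prime_odd_nat p1 by fastforce
  have "odd r" using r1 p2 by (auto simp: cong_def odd_iff_mod_2_eq_one)
  moreover have "r mod 4 \<noteq> 1" using bad p2 by (auto simp: cong_def)
  ultimately have "r mod 4 = 3" by presburger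
  then obtain q where q: "r = 4 * q + 3" by (metis mult_div_mod_eq)
  show k2: "k \<ge> 2"
  proof (rule ccontr)
    assume "\<not> k \<ge> 2"
    then have "k = 1" using a(3) by simp
    then show False using rlt p2 q by simp
  qed
  then have K: "(2::nat) ^ k = 2 * 2 ^ (k - 1)" by (cases k) auto
  have x2: "x [^] (2::nat) = a [^] s" using s p2 by simp
  have cop: "coprime (2 ^ (k - 1)) (2 * q + 1)" by simp
  \<comment> \<open>\<open>x\<close> commutes with its square \<open>a [^] s\<close>, so
    \<open>2 ^ k\<close> divides \<open>(r - 1) * s\<close>. Since \<open>r - 1\<close> is twice an
    odd number, \<open>2 ^ (k - 1)\<close> divides \<open>s\<close>.\<close>
  have "a [^] (r * s) \<otimes> x = x \<otimes> x [^] (2::nat)"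
    using twist_nat_pow[OF a(1) x(1) twist, of 1 s] by (simp add: x2)
  also have "\<dots> = a [^] s \<otimes> x" using x2 by (metis x(1) nat_pow_Suc nat_pow_Suc2)
  finally have "a [^] (r * s) = a [^] s" by simp
  then have "[r * s = s] (mod 2 ^ k)" by (simp only: nat_pow_eq_iff[OF a(1)] a(2) p2)
  then have "2 ^ k dvd r * s - s" using q by (intro cong_altdef_nat[THEN iffD1, rotated]) auto
  also have "r * s - s = 2 * ((2 * q + 1) * s)" by (simp add: q algebra_simps)
  finally have "2 ^ (k - 1) dvd (2 * q + 1) * s"
    unfolding K by (metis nat_mult_dvd_cancel1 pos2)
  then obtain s' where s': "s = 2 ^ (k - 1) * s'"
    using cop coprime_dvd_mult_right_iff by blast
  have "odd s'"
  proof
    assume "even s'"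
    then have "2 ^ k dvd s" unfolding K s' by auto
    then have "x [^] p = \<one>" unfolding s by (simp add: pow_eq_id a(2) p2)
    then show False using none x by blast
  qed
  have half: "[2 ^ (k - 1) * d = 2 ^ (k - 1)] (mod 2 ^ k)" if d: "odd d" for d :: nat
  proof -
    obtain e where e: "d = 2 * e + 1" using d by (rule oddE)
    have "2 ^ (k - 1) * d = 2 ^ (k - 1) + 2 ^ k * e" unfolding e K by (simp only: algebra_simps)
    then show ?thesis by (simp add: cong_def)
  qed
  show "x [^] (2::nat) = a [^] (2 ^ (k - 1) :: nat)"
    unfolding x2 using half[OF \<open>odd s'\<close>] by (simp add: nat_pow_eq_iff a(2) p2 s')
  \<comment> \<open>Splitting off \<open>r - 1\<close>, twice an odd number, leaves
    \<open>2 ^ (k - 1)\<close> dividing \<open>r + 1\<close>. An odd quotient would make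
    \<open>(a x)^2 = a^(r + 1) a^s\<close> trivial, because two odd multiples of
    \<open>2 ^ (k - 1)\<close> add up to a multiple of \<open>2 ^ k\<close>.\<close>
  have "2 ^ k dvd r ^ 2 - 1"
    using rp q by (intro cong_altdef_nat[THEN iffD1, rotated]) (auto simp: p2)
  also have "r ^ 2 - 1 = 2 * ((2 * q + 1) * (r + 1))" by (simp add: q power2_eq_square algebra_simps)
  finally have "2 ^ (k - 1) dvd (2 * q + 1) * (r + 1)"
    unfolding K by (metis nat_mult_dvd_cancel1 pos2)
  then obtain r' where r': "r + 1 = 2 ^ (k - 1) * r'"
    using cop coprime_dvd_mult_right_iff by blast
  have "even r'"
  proof (rule ccontr)
    assume "odd r'"
    have "(a [^] (1::nat) \<otimes> x) [^] (2::nat) = a [^] (r + 1) \<otimes> a [^] s"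
      using nat_pow_twisted_mult[OF a(1) x(1) twist, of 1 2]
      by (simp only: x2) (simp add: eval_nat_numeral)
    also have "\<dots> = a [^] (2 ^ (k - 1) * (r' + s'))"
      by (simp only: r' s') (simp add: nat_pow_mult algebra_simps)
    also have "\<dots> = \<one>" using \<open>odd r'\<close> \<open>odd s'\<close> by (auto simp: pow_eq_id a(2) p2 K)
    finally show False using none[OF _ coset[of 1]] p2 by simp
  qed
  then have "2 ^ k dvd r + 1" unfolding r' K by auto
  then have "a [^] (r + 1) = \<one>" by (simp only: pow_eq_id[OF a(1)] a(2) p2)
  then have "a [^] r \<otimes> a = \<one>" by simp
  then show "x \<otimes> a \<otimes> inv x = inv a" unfolding conj by (simp add: inv_equality)
qed

lemma (in group) conj_nat_pow:
  fixes m :: nat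
  assumes "g \<in> carrier G" "a \<in> carrier G"
  shows "(g \<otimes> a \<otimes> inv g) [^] m = g \<otimes> a [^] m \<otimes> inv g"
proof (induction m)
  case (Suc m)
  have "(g \<otimes> a \<otimes> inv g) [^] Suc m = (g \<otimes> a [^] m \<otimes> inv g) \<otimes> (g \<otimes> a \<otimes> inv g)"
    by (simp only: nat_pow_Suc Suc)
  also have "\<dots> = g \<otimes> a [^] m \<otimes> (inv g \<otimes> g) \<otimes> a \<otimes> inv g"
    using assms by (simp add: m_assoc[symmetric] del: l_inv) (simp add: m_assoc)
  finally have "(g \<otimes> a \<otimes> inv g) [^] Suc m = g \<otimes> a [^] m \<otimes> (inv g \<otimes> g) \<otimes> a \<otimes> inv g" .
  then show ?case using assms by (simp add: m_assoc)
qed (use assms in simp)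

text \<open>\<open>a\<close> has maximal order. By \<open>cyclic_p_subgroup_extension\<close> every element normalizing \<open>A = \<langle>a\<rangle>\<close>
  but outside of it inverts \<open>a\<close>: a power of it does, and \<open>-1\<close> is not a square modulo \<open>4\<close>.
  Hence \<open>A\<close> has index two in its normalizer \<open>N\<close>. If an element \<open>g \<notin> N\<close> normalized \<open>N\<close>, then
  \<open>g a g\<^sup>-\<^sup>1 \<in> N - A\<close> would have order four; but in exponent four all squares lie in \<open>A\<close>, which
  makes \<open>A\<close> normal.\<close>

lemma (in group) noncyclic_p_group_unique_subgroup:
  assumes pG: "p_group p G" and fin: "finite (carrier G)" and noncyclic: "\<not> cyclic_group G"
    and uniq: "\<And>u v. u \<in> carrier G \<Longrightarrow> v \<in> carrier G \<Longrightarrow> u \<noteq> \<one> \<Longrightarrow> u [^] p = \<one> \<Longrightarrow> v [^] p = \<one> \<Longrightarrow>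
      v \<in> generate G {u}"
  obtains a b k where "a \<in> carrier G" "b \<in> carrier G" "k \<ge> 2" "ord a = 2 ^ k"
    "b \<notin> generate G {a}" "b \<otimes> a = inv a \<otimes> b" "b [^] (2::nat) = a [^] (2 ^ (k - 1) :: nat)"
    "\<And>y. y \<in> carrier G \<Longrightarrow> y \<in> generate G {a} \<or> y \<otimes> inv b \<in> generate G {a}"
proof -
  have p: "prime p" using pG by (simp add: p_group_def)
  have ord_pow: "\<exists>k. ord x = p ^ k" if "x \<in> carrier G" for x
    using pG that by (auto simp: p_group_def)
  obtain m where om: "Coset.order G = p ^ m" using p_group_order_prime_power[OF pG fin] .
  define M where "M = Max (ord ` carrier G)"
  have finM: "finite (ord ` carrier G)" "ord ` carrier G \<noteq> {}" using fin by auto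
  then obtain a where a: "a \<in> carrier G" "ord a = M"
    using Max_in[OF finM] unfolding M_def by (metis imageE)
  have max: "ord x \<le> ord a" if "x \<in> carrier G" for x
    unfolding a(2) M_def using finM that by (intro Max_ge) auto
  obtain k where k: "ord a = p ^ k" using ord_pow a by blast
  have k1: "k \<ge> 1"
  proof (rule ccontr)
    assume "\<not> k \<ge> 1"
    then have "ord x = 1" if "x \<in> carrier G" for x
      using max[OF that] ord_ge_1[OF fin that] k by (simp add: not_less_eq_eq)
    then have "carrier G = {\<one>}" using ord_eq_1 by auto
    then show False using pG fin by (auto simp: p_group_def Coset.order_def)
  qed
  define A where "A = generate G {a}"
  note memA = mem_generate_singleton_iff[OF fin a(1), folded A_def]
  have subA: "subgroup A G" unfolding A_def using a by (intro generate_is_subgroup) auto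
  have [simp]: "a \<in> carrier G" by (rule a)
  note Amult = subgroup.m_closed[OF subA] and Ainv = subgroup.m_inv_closed[OF subA]
  have AC: "x \<in> carrier G" if "x \<in> A" for x using subgroup.mem_carrier[OF subA that] .
  have none: "y [^] p \<noteq> \<one>" if "y \<in> carrier G" "y \<notin> A" for y
  proof
    assume y: "y [^] p = \<one>"
    \<comment> \<open>An element of order \<open>p\<close> in \<open>A\<close>. By
      \<open>uniq\<close> every solution of \<open>y [^] p = \<one>\<close> lies in the subgroup it
      generates, hence in \<open>A\<close>.\<close>
    define z where "z = a [^] (p ^ (k - 1))"
    have K: "p ^ k = p ^ (k - 1) * p" using k1 by (cases k) auto
    have "z [^] p = a [^] (p ^ k)" unfolding K z_def by (rule nat_pow_pow[OF a(1)])
    then have "z [^] p = \<one>" by (simp add: pow_eq_id k)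
    moreover have "\<not> p ^ k dvd p ^ (k - 1)"
    proof
      assume "p ^ k dvd p ^ (k - 1)"
      then have "k \<le> k - 1" using prime_gt_1_nat[OF p] by (rule power_dvd_imp_le)
      then show False using k1 by simp
    qed
    then have "z \<noteq> \<one>" by (simp add: z_def pow_eq_id k)
    ultimately have "y \<in> generate G {z}" using uniq[of z y] that y by (simp add: z_def)
    then obtain i :: nat where "y = z [^] i"
      using mem_generate_singleton_iff[OF fin, of z] by (auto simp: z_def)
    then show False using that(2) memA by (auto simp: z_def nat_pow_pow)
  qed
  have "A \<noteq> carrier G"
  proof
    assume "A = carrier G"
    then have "carrier G = {a [^] n | n. n \<in> (UNIV :: int set)}"
      using generate_pow[OF a(1)] by (simp add: A_def)
    also have "\<dots> = range (\<lambda>n::int. a [^] n)" by auto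
    finally have "carrier G = range (\<lambda>n::int. a [^] n)" .
    then show False using noncyclic cyclic_group a by blast
  qed

  \<comment> \<open>The normalizer of \<open>A\<close>, phrased by commutation so that
    \<open>twist_nat_pow\<close> gives closure under powers and products; inverses are powers by
    finiteness.\<close>
  define N where "N = {g \<in> carrier G. \<exists>r::nat. g \<otimes> a = a [^] r \<otimes> g}"
  have conjA: "x \<otimes> a \<otimes> inv x \<in> A" if xN: "x \<in> N" for x
  proof -
    obtain r :: nat where r: "x \<in> carrier G" "x \<otimes> a = a [^] r \<otimes> x" using xN by (auto simp: N_def)
    then have "x \<otimes> a \<otimes> inv x = a [^] r" by (simp add: m_assoc)
    then show ?thesis using memA by blast
  qed
  have NI: "x \<in> N" if x: "x \<in> carrier G" "x \<otimes> a \<otimes> inv x \<in> A" for x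
  proof -
    obtain r :: nat where r: "x \<otimes> a \<otimes> inv x = a [^] r" using x memA by blast
    then have "x \<otimes> a = a [^] r \<otimes> x"
      using x by (metis a(1) inv_closed inv_solve_right' m_closed nat_pow_closed)
    then show ?thesis using x by (auto simp: N_def)
  qed
  have NC: "x \<in> carrier G" if "x \<in> N" for x using that by (simp add: N_def)
  have AN: "A \<subseteq> N"
  proof
    fix x assume "x \<in> A"
    moreover have "a \<in> A" using memA by (metis a(1) nat_pow_eone)
    ultimately show "x \<in> N" by (intro NI Amult Ainv AC)
  qed
  have Npow: "x [^] (i::nat) \<in> N" if xN: "x \<in> N" for x i
  proof -
    obtain r :: nat where "x \<otimes> a = a [^] r \<otimes> x" using xN by (auto simp: N_def)
    then have "x [^] i \<otimes> a = a [^] (r ^ i) \<otimes> x [^] i"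
      using twist_nat_pow[of a x r i 1] NC[OF that] by simp
    then show ?thesis using NC[OF that] by (auto simp: N_def)
  qed
  have Nmult: "x \<otimes> y \<in> N" if xy: "x \<in> N" "y \<in> N" for x y
  proof -
    obtain r s :: nat where rs: "x \<otimes> a = a [^] r \<otimes> x" "y \<otimes> a = a [^] s \<otimes> y"
      using xy by (auto simp: N_def)
    have "(x \<otimes> y) \<otimes> a = (x \<otimes> a [^] s) \<otimes> y" using NC that rs by (simp add: m_assoc)
    also have "x \<otimes> a [^] s = a [^] (r * s) \<otimes> x"
      using twist_nat_pow[of a x r 1 s] NC[OF that(1)] rs by simp
    finally have "(x \<otimes> y) \<otimes> a = a [^] (r * s) \<otimes> (x \<otimes> y)" using NC that by (simp add: m_assoc)
    then show ?thesis using NC that by (auto simp: N_def)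
  qed
  have Ninv: "inv x \<in> N" if "x \<in> N" for x
  proof -
    have x: "x \<in> carrier G" by (rule NC[OF that])
    have "x [^] (ord x - 1) \<otimes> x = x [^] (Suc (ord x - 1))" by simp
    also have "\<dots> = \<one>" using ord_ge_1[OF fin x] pow_ord_eq_1[OF x] by simp
    finally have "inv x = x [^] (ord x - 1)" using x by (intro inv_equality) auto
    then show ?thesis using Npow[OF that] by simp
  qed
  have subN: "subgroup N G"
    by (rule subgroupI) (use NC AN subgroup.one_closed[OF subA] Nmult Ninv in auto)

  have invert: "p = 2 \<and> k \<ge> 2 \<and> y \<otimes> a = inv a \<otimes> y \<and> y [^] (2::nat) = a [^] (2 ^ (k - 1) :: nat)"
    if y: "y \<in> N" "y \<notin> A" for y
  proof -
    \<comment> \<open>The extension lemma needs an element whose \<open>p\<close>-th power is in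
      \<open>A\<close>, so it is applied to the last iterated \<open>p\<close>-th power
      \<open>x\<close> of \<open>y\<close> outside \<open>A\<close>. If \<open>x\<close> were not
      \<open>y\<close> itself, it would be the square of an element of \<open>N\<close>.\<close>
    have "\<exists>i. y [^] (p ^ i) \<in> A"
      using ord_pow[OF NC[OF y(1)]] pow_ord_eq_1[OF NC[OF y(1)]] subgroup.one_closed[OF subA] by metis
    then obtain j where j: "y [^] (p ^ j) \<in> A" "\<And>i. i < j \<Longrightarrow> y [^] (p ^ i) \<notin> A"
      using exists_least_iff[of "\<lambda>i. y [^] (p ^ i) \<in> A"] by blast
    have "j \<noteq> 0" using j(1) y NC by (metis nat_pow_eone power_0)
    then obtain l where l: "j = Suc l" using not0_implies_Suc by blast
    define x where "x = y [^] (p ^ l)"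
    have xN: "x \<in> N" unfolding x_def by (rule Npow[OF y(1)])
    have xA: "x \<notin> A" unfolding x_def using j(2) l by simp
    have "x [^] p = y [^] (p ^ j)" using NC[OF y(1)] by (simp add: x_def l nat_pow_pow mult.commute)
    then have xpA: "x [^] p \<in> A" using j(1) by simp
    note ext = cyclic_p_subgroup_extension[OF fin p a(1) k k1 NC[OF xN], folded A_def,
        OF xA xpA conjA[OF xN] max[OF NC[OF xN]] none]
    have x_inv: "x \<otimes> a = inv a \<otimes> x"
      using ext(3) NC[OF xN] by (metis a(1) inv_closed inv_solve_right' m_closed)
    have "l = 0"
    proof (rule ccontr)
      assume "l \<noteq> 0"
      then obtain l' where l': "l = Suc l'" using not0_implies_Suc by blast
      define w where "w = y [^] (p ^ l')"
      have wN: "w \<in> N" unfolding w_def by (rule Npow[OF y(1)])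
      have xw: "x = w [^] (2::nat)"
        using NC[OF y(1)] ext(1) by (simp add: x_def w_def l' nat_pow_pow mult.commute)
      obtain u :: nat where u: "w \<otimes> a = a [^] u \<otimes> w" using wN by (auto simp: N_def)
      have "inv a \<otimes> x = a [^] (u\<^sup>2) \<otimes> x"
        using twist_nat_pow[OF a(1) NC[OF wN] u, of 2 1] x_inv by (simp add: xw)
      then have "inv a = a [^] (u\<^sup>2)" using NC[OF xN] by simp
      then have "a [^] Suc (u\<^sup>2) = \<one>" by (metis a(1) l_inv nat_pow_Suc)
      then have "2 ^ k dvd Suc (u\<^sup>2)" using k ext(1) by (metis pow_eq_id a(1))
      moreover have "(2::nat) ^ 2 dvd 2 ^ k" using ext(2) by (rule le_imp_power_dvd)
      ultimately have "4 dvd Suc (u\<^sup>2)" using dvd_trans by fastforce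
      moreover have "u\<^sup>2 mod 4 = 0 \<or> u\<^sup>2 mod 4 = 1"
      proof -
        have "u mod 4 = 0 \<or> u mod 4 = 1 \<or> u mod 4 = 2 \<or> u mod 4 = 3" by presburger
        then show ?thesis by (auto simp: power_mod[of u 4 2, symmetric])
      qed
      ultimately show False by presburger
    qed
    then have "x = y" using NC[OF y(1)] by (simp add: x_def)
    then show ?thesis using ext x_inv by simp
  qed
  \<comment> \<open>The product of two elements inverting \<open>a\<close> centralizes
    \<open>a\<close>. Outside \<open>A\<close> it would invert \<open>a\<close> as well, so
    \<open>a\<close> would have order at most 2, while its order is at least 4.\<close>
  have square: "x \<otimes> y \<in> A" if "x \<in> N" "x \<notin> A" "y \<in> N" "y \<notin> A" for x y
  proof (rule ccontr)
    assume "x \<otimes> y \<notin> A"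
    note xC = NC[OF that(1)] and yC = NC[OF that(3)]
    have 1: "(x \<otimes> y) \<otimes> a = inv a \<otimes> (x \<otimes> y)"
      using invert[OF Nmult[OF that(1,3)] \<open>x \<otimes> y \<notin> A\<close>] by blast
    have xa: "x \<otimes> a = inv a \<otimes> x" and ya: "y \<otimes> a = inv a \<otimes> y" using invert that by blast+
    have "x \<otimes> inv a = a \<otimes> x"
    proof -
      have "a \<otimes> (x \<otimes> a) \<otimes> inv a = x \<otimes> inv a"
        unfolding xa using xC by (simp add: m_assoc[symmetric])
      then show ?thesis using xC by (simp add: m_assoc)
    qed
    then have "(x \<otimes> y) \<otimes> a = a \<otimes> (x \<otimes> y)"
      using xC yC ya by (simp add: m_assoc) (simp add: m_assoc[symmetric])
    then have "inv a = a" using 1 xC yC by simp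
    then have "a \<otimes> a = \<one>" by (metis a(1) r_inv)
    then have "a [^] (2::nat) = \<one>" by (simp add: numeral_2_eq_2)
    then have "ord a dvd 2" by (simp only: pow_eq_id[OF a(1)])
    moreover have "p = 2" "k \<ge> 2" using invert[OF that(1,2)] by simp_all
    then have "(2::nat) ^ 2 dvd ord a" unfolding k by (simp only: le_imp_power_dvd)
    ultimately have "(2::nat) ^ 2 dvd 2" by (rule dvd_trans[rotated])
    then show False by simp
  qed
  have "N = carrier G"
  proof (rule ccontr)
    assume "N \<noteq> carrier G"
    then obtain g where g: "g \<in> carrier G" "g \<notin> N" "\<And>h. h \<in> N \<Longrightarrow> g \<otimes> h \<otimes> inv g \<in> N"
      using normalizer_grows[OF fin p om subN] by blast
    define c where "c = g \<otimes> a \<otimes> inv g"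
    have aA: "a \<in> A" using memA by (metis a(1) nat_pow_eone)
    then have "c \<in> N" using g(3) AN by (auto simp: c_def)
    moreover have "c \<notin> A" using g NI by (auto simp: c_def)
    ultimately have c: "p = 2" "k \<ge> 2" "c [^] (2::nat) = a [^] (2 ^ (k - 1) :: nat)"
      using invert by blast+
    have K: "(2::nat) ^ k = 2 ^ (k - 1) * 2" using k1 by (cases k) auto
    have "c [^] (4::nat) = (c [^] (2::nat)) [^] (2::nat)" using g by (simp add: c_def nat_pow_pow)
    also have "\<dots> = a [^] ((2::nat) ^ k)" unfolding c(3) by (simp add: nat_pow_pow K)
    also have "\<dots> = \<one>" using k c(1) by (simp add: pow_eq_id)
    finally have "g \<otimes> a [^] (4::nat) \<otimes> inv g = \<one>" unfolding c_def using conj_nat_pow g by simp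
    then have "a [^] (4::nat) = \<one>"
      using g by (metis a(1) inv_closed inv_solve_right' l_cancel_one m_closed nat_pow_closed one_closed r_one l_one)
    then have "2 ^ k dvd (2::nat) ^ 2" using k c(1) by (simp add: pow_eq_id)
    then have "k \<le> 2" by (rule power_dvd_imp_le) simp
    then have k2: "ord a = 4" using k c(1,2) by simp
    define z where "z = a [^] (2::nat)"
    have z: "z \<in> carrier G" "z \<noteq> \<one>" "z [^] p = \<one>"
      using k2 by (simp_all add: z_def pow_eq_id nat_pow_pow c(1))
    \<comment> \<open>All orders divide 4, so a square is killed by 2 and lies in the subgroup
      generated by \<open>z\<close>.\<close>
    have sq: "y \<otimes> y \<in> A" if y: "y \<in> carrier G" for y
    proof -
      obtain i where i: "ord y = 2 ^ i" using ord_pow[OF y] c(1) by blast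
      then have "(2::nat) ^ i \<le> 2 ^ 2" using max[OF y] k2 by simp
      then have "i \<le> 2" by (rule power_le_imp_le_exp[rotated]) simp
      then have "ord y dvd 2 ^ 2" unfolding i by (rule le_imp_power_dvd)
      then have "(y \<otimes> y) [^] p = \<one>"
        using y c(1) by (simp add: pow_eq_id[symmetric] numeral_2_eq_2 m_assoc eval_nat_numeral)
      then have "y \<otimes> y \<in> generate G {z}" using uniq z y by simp
      then obtain i :: nat where "y \<otimes> y = z [^] i"
        using mem_generate_singleton_iff[OF fin z(1)] by blast
      then show ?thesis using memA by (auto simp: z_def nat_pow_pow)
    qed
    \<comment> \<open>Expresses the conjugate through the squares of \<open>g \<otimes> a\<close>
      and \<open>g\<close> and through \<open>a\<close>, all of which lie in
      \<open>A\<close>.\<close>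
    have "g \<otimes> a \<otimes> inv g = ((g \<otimes> a) \<otimes> (g \<otimes> a)) \<otimes> inv a \<otimes> inv (g \<otimes> g)"
    proof -
      have "((g \<otimes> a) \<otimes> (g \<otimes> a)) \<otimes> inv a \<otimes> inv (g \<otimes> g) = g \<otimes> a \<otimes> g \<otimes> (a \<otimes> inv a) \<otimes> inv g \<otimes> inv g"
        using g by (simp only: m_assoc inv_mult_group m_closed inv_closed a(1))
      also have "\<dots> = g \<otimes> a \<otimes> g \<otimes> inv g \<otimes> inv g" using g by simp
      also have "\<dots> = g \<otimes> a \<otimes> (g \<otimes> inv g) \<otimes> inv g"
        using g by (simp only: m_assoc m_closed inv_closed a(1))
      also have "\<dots> = g \<otimes> a \<otimes> inv g" using g by simp
      finally show ?thesis by simp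
    qed
    also have "\<dots> \<in> A" using Amult[OF Amult[OF sq[of "g \<otimes> a"] Ainv[OF aA]] Ainv[OF sq[of g]]] g by simp
    finally show False using NI g by blast
  qed
  moreover obtain b where "b \<in> carrier G" "b \<notin> A"
    using \<open>A \<noteq> carrier G\<close> AC by blast
  ultimately have b: "b \<in> N" "b \<notin> A" by simp_all
  show ?thesis
  proof (rule that[of a b k, folded A_def])
    show "ord a = 2 ^ k" using k invert[OF b] by simp
    fix y assume y: "y \<in> carrier G"
    show "y \<in> A \<or> y \<otimes> inv b \<in> A"
    proof (cases "y \<in> A")
      case False
      have "inv b \<notin> A" using Ainv[of "inv b"] b NC by auto
      then show ?thesis using square[OF _ False Ninv[OF b(1)]] y \<open>N = carrier G\<close> by simp
    qed simp
  qed (use b NC invert[OF b] in simp_all)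
qed

section \<open>Generalized quaternion groups\<close>

lemma (in group) word_eval_closed [simp]:
  "range f \<subseteq> carrier G \<Longrightarrow> word_eval G f w \<in> carrier G"
  by (induction w) (auto simp: image_subset_iff)

lemma (in group) word_eval_append:
  "range f \<subseteq> carrier G \<Longrightarrow> word_eval G f (u @ v) = word_eval G f u \<otimes> word_eval G f v"
  by (induction u) (auto simp: image_subset_iff m_assoc)

lemma (in group) word_eval_replicate:
  assumes "range f \<subseteq> carrier G"
  shows "word_eval G f (replicate k (x, True)) = f x [^] k"
proof (induction k)
  case (Suc k)
  have "f x \<in> carrier G" using assms by blast
  from nat_pow_Suc2[OF this, of k] show ?case by (simp add: Suc)
qed simp

lemma (in group) word_eval_cong:
  assumes f: "range f \<subseteq> carrier G"
    and R: "\<And>u v. (u, v) \<in> R \<Longrightarrow> word_eval G f u = word_eval G f v"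
    and "word_cong R u v"
  shows "word_eval G f u = word_eval G f v"
  using assms(3)
proof (induction rule: word_cong.induct)
  case (cancel x s)
  have "f x \<in> carrier G" using f by blast
  then show ?case by simp
next
  case (append u u' v v')
  then show ?case using f by (simp add: word_eval_append)
qed (use R in auto)

text \<open>The relations move each \<open>b\<close> to the right of all \<open>a\<close>, absorb
  pairs of \<open>b\<close> into \<open>a^n\<close> and reduce the exponent of \<open>a\<close>
  modulo \<open>2 * n\<close>. The presented group thus has at most \<open>4 * n\<close>
  elements.\<close>

lemma quaternion_normal_form:
  assumes n: "n \<ge> 1"
  obtains i j where "i < 2 * n" "j < 2"
    "word_cong (quaternion_relations n) w (replicate i (Gen_a, True) @ replicate j (Gen_b, True))"
proof -
  let ?R = "quaternion_relations n"
  define E where "E = word_cong ?R"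
  define A where "A i = replicate i (Gen_a, True)" for i
  define b where "b = (Gen_b, True)"
  have [trans]: "E u v \<Longrightarrow> E v w \<Longrightarrow> E u w" for u v w
    unfolding E_def by (rule word_cong.trans)
  have refl [simp]: "E u u" for u unfolding E_def by (rule word_cong.refl)
  have sym: "E u v \<Longrightarrow> E v u" for u v unfolding E_def by (rule word_cong.sym)
  have app: "E u v \<Longrightarrow> E (x @ u @ y) (x @ v @ y)" for u v x y
    unfolding E_def by (intro word_cong.append word_cong.refl)
  have pre: "E u v \<Longrightarrow> E (x @ u) (x @ v)" for u v x using app[of u v x "[]"] by simp
  have suf: "E u v \<Longrightarrow> E (u @ y) (v @ y)" for u v y using app[of u v "[]" y] by simp
  have cancel: "E [(x, s), (x, \<not> s)] []" for x s unfolding E_def by (rule word_cong.cancel)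
  have A_add: "A (i + j) = A i @ A j" for i j by (simp add: A_def replicate_add)
  have A1: "A (Suc 0) = [(Gen_a, True)]" by (simp add: A_def)
  have A2n: "E (A (2 * n)) []" and An: "E (A n) [b, b]"
    and ab: "E [(Gen_a, True), b] [b, (Gen_a, False)]"
    unfolding E_def A_def b_def
    by (auto intro!: word_cong.rel simp: quaternion_relations_def numeral_2_eq_2)
  have A_mult: "E (A (2 * n * q)) []" for q
  proof (induction q)
    case (Suc q)
    have "A (2 * n * Suc q) = A (2 * n) @ A (2 * n * q)" by (simp add: A_add[symmetric])
    also have "E \<dots> (A (2 * n * q))" using suf[OF A2n] by simp
    also note Suc
    finally show ?case .
  qed (simp add: A_def)
  have A_mod: "E (A i) (A (i mod (2 * n)))" for i
  proof -
    have "A i = A (2 * n * (i div (2 * n))) @ A (i mod (2 * n))"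
      by (simp only: A_add[symmetric] mult_div_mod_eq)
    also have "E \<dots> (A (i mod (2 * n)))" using suf[OF A_mult] by simp
    finally show ?thesis .
  qed
  have a_inv: "E [(Gen_a, False)] (A (2 * n - 1))"
  proof -
    have "E [(Gen_a, False)] ([(Gen_a, False)] @ A (2 * n))"
      using pre[OF sym[OF A2n], of "[(Gen_a, False)]"] by simp
    also have "[(Gen_a, False)] @ A (2 * n) = [(Gen_a, False), (Gen_a, True)] @ A (2 * n - 1)"
      using A_add[of 1 "2 * n - 1"] n by (simp add: A1)
    also have "E \<dots> (A (2 * n - 1))" using suf[OF cancel[of Gen_a False]] by simp
    finally show ?thesis .
  qed
  have ba: "E [b, (Gen_a, True)] (A (2 * n - 1) @ [b])"
  proof -
    have "E ([] @ [b, (Gen_a, True)]) ([(Gen_a, False), (Gen_a, True)] @ [b, (Gen_a, True)])"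
      using suf[OF sym[OF cancel[of Gen_a False]]] by simp
    also have "\<dots> = [(Gen_a, False)] @ [(Gen_a, True), b] @ [(Gen_a, True)]" by simp
    also have "E \<dots> ([(Gen_a, False)] @ [b, (Gen_a, False)] @ [(Gen_a, True)])"
      by (rule app[OF ab])
    also have "\<dots> = [(Gen_a, False), b] @ [(Gen_a, False), (Gen_a, True)]" by simp
    also have "E \<dots> ([(Gen_a, False), b] @ [])" by (rule pre) (use cancel[of Gen_a False] in simp)
    also have "\<dots> = [(Gen_a, False)] @ [b]" by simp
    also have "E \<dots> (A (2 * n - 1) @ [b])" by (rule suf[OF a_inv])
    finally show ?thesis by simp
  qed
  have bA: "E ([b] @ A i) (A ((2 * n - 1) * i) @ [b])" for i
  proof (induction i)
    case (Suc i)
    have "[b] @ A (Suc i) = [b, (Gen_a, True)] @ A i" by (simp add: A_def)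
    also have "E \<dots> ((A (2 * n - 1) @ [b]) @ A i)" by (rule suf[OF ba])
    also have "\<dots> = A (2 * n - 1) @ ([b] @ A i)" by simp
    also have "E \<dots> (A (2 * n - 1) @ (A ((2 * n - 1) * i) @ [b]))" by (rule pre[OF Suc])
    also have "\<dots> = A ((2 * n - 1) * Suc i) @ [b]" by (simp add: A_add)
    finally show ?case .
  qed (simp add: A_def)
  \<comment> \<open>Inserts \<open>a^(2n) = a^n a^n\<close> and turns one half into
    \<open>b b\<close>, against which the inverse letter cancels.\<close>
  have b_inv: "E [(Gen_b, False)] (A ((2 * n - 1) * n) @ [b])"
  proof -
    have "E [(Gen_b, False)] ([(Gen_b, False)] @ A (2 * n))"
      using pre[OF sym[OF A2n], of "[(Gen_b, False)]"] by simp
    also have "[(Gen_b, False)] @ A (2 * n) = [(Gen_b, False)] @ A n @ A n"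
      by (simp add: A_add mult_2)
    also have "E \<dots> ([(Gen_b, False)] @ [b, b] @ A n)" by (rule app[OF An])
    also have "\<dots> = [(Gen_b, False), (Gen_b, True)] @ ([b] @ A n)" by (simp add: b_def)
    also have "E \<dots> ([b] @ A n)" using suf[OF cancel[of Gen_b False]] by simp
    also note bA
    finally show ?thesis .
  qed
  \<comment> \<open>The exponent of \<open>a\<close> is left unbounded, so that prefixing powers of
    \<open>a\<close> only adds to it; it is reduced once at the end.\<close>
  define nf where "nf w \<longleftrightarrow> (\<exists>i j. j < 2 \<and> E w (A i @ replicate j b))" for w
  have nfE: "nf w" if wv: "E w v" "nf v" for w v
  proof -
    obtain i j where ij: "j < 2" "E v (A i @ replicate j b)" using wv(2) by (auto simp: nf_def)
    note wv(1) also note ij(2)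
    finally show ?thesis using ij(1) by (auto simp: nf_def)
  qed
  have nfA: "nf (A m @ w)" if w: "nf w" for m w
  proof -
    obtain i j where ij: "j < 2" "E w (A i @ replicate j b)" using w by (auto simp: nf_def)
    have "E (A m @ w) (A (m + i) @ replicate j b)" using pre[OF ij(2), of "A m"] by (simp add: A_add)
    then show ?thesis using ij(1) by (auto simp: nf_def)
  qed
  have nfb: "nf (b # w)" if w: "nf w" for w
  proof -
    obtain i j where ij: "j < 2" "E w (A i @ replicate j b)" using w by (auto simp: nf_def)
    have "E (b # w) ([b] @ A i @ replicate j b)" using pre[OF ij(2), of "[b]"] by simp
    moreover have "E ([b] @ A i @ replicate j b) ((A ((2 * n - 1) * i) @ [b]) @ replicate j b)"
      using suf[OF bA] by simp
    moreover have "nf ([b] @ replicate j b)"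
    proof (cases "j = 0")
      case True
      then have "E ([b] @ replicate j b) (A 0 @ replicate 1 b)" by (simp add: A_def)
      then show ?thesis unfolding nf_def by (metis one_less_numeral_iff semiring_norm(76))
    next
      case False
      then have "j = 1" using ij(1) by simp
      then have "E ([b] @ replicate j b) (A n @ replicate 0 b)" using sym[OF An] by simp
      then show ?thesis unfolding nf_def by (metis pos2)
    qed
    ultimately show ?thesis using nfE nfA by (metis append_assoc)
  qed
  have "nf w"
  proof (induction w)
    case Nil
    have "E [] (A 0 @ replicate 0 b)" by (simp add: A_def)
    then show ?case unfolding nf_def by (metis pos2)
  next
    case (Cons l w)
    obtain x s where l: "l = (x, s)" by (cases l)
    consider "x = Gen_a" "s" | "x = Gen_a" "\<not> s" | "x = Gen_b" "s" | "x = Gen_b" "\<not> s"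
      by (cases x) auto
    then show ?case
    proof cases
      case 1
      then have "l # w = A 1 @ w" by (simp add: l A_def)
      then show ?thesis using nfA[OF Cons, of 1] by (simp only:)
    next
      case 2
      then have "E (l # w) (A (2 * n - 1) @ w)" using suf[OF a_inv, of w] by (simp add: l)
      then show ?thesis using nfE nfA[OF Cons] by blast
    next
      case 3
      then show ?thesis using nfb[OF Cons] by (simp add: l b_def)
    next
      case 4
      then have "E (l # w) (A ((2 * n - 1) * n) @ (b # w))" using suf[OF b_inv, of w] by (simp add: l)
      then show ?thesis using nfE nfA[OF nfb[OF Cons]] by blast
    qed
  qed
  then obtain i j where ij: "j < 2" "E w (A i @ replicate j b)" by (auto simp: nf_def)
  note ij(2)
  also have "E (A i @ replicate j b) (A (i mod (2 * n)) @ replicate j b)" by (rule suf[OF A_mod])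
  finally have "word_cong ?R w (replicate (i mod (2 * n)) (Gen_a, True) @ replicate j (Gen_b, True))"
    by (simp add: E_def A_def b_def)
  then show ?thesis by (rule that[OF _ ij(1), rotated]) (use n in simp)
qed

text \<open>The group is the disjoint union of two cosets of the subgroup generated by
  \<open>a\<close>, so normal forms evaluate bijectively onto it. Hence words of equal value share
  their normal form and are congruent: no further relations hold.\<close>

lemma (in group) generalized_quaternionI:
  assumes fin: "finite (carrier G)" and ab: "a \<in> carrier G" "b \<in> carrier G"
    and k: "k \<ge> 2" and ord: "ord a = 2 ^ k" and bA: "b \<notin> generate G {a}"
    and twist: "b \<otimes> a = inv a \<otimes> b" and b2: "b [^] (2::nat) = a [^] (2 ^ (k - 1) :: nat)"
    and cover: "\<And>y. y \<in> carrier G \<Longrightarrow> y \<in> generate G {a} \<or> y \<otimes> inv b \<in> generate G {a}"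
  shows "generalized_quaternion G"
proof -
  define n :: nat where "n = 2 ^ (k - 1)"
  have K: "(2::nat) ^ k = 2 * n" using k by (cases k) (auto simp: n_def)
  have n2: "n \<ge> 2" unfolding n_def using k power_increasing[of 1 "k - 1" "2::nat"] by simp
  note [simp] = ab
  note mem = mem_generate_singleton_iff[OF fin ab(1)]
  define h where "h = (\<lambda>(i::nat, j::nat). a [^] i \<otimes> b [^] j)"
  define D :: "(nat \<times> nat) set" where "D = {..<2 * n} \<times> {..<2}"
  have inj: "inj_on h D"
  proof (rule inj_onI)
    fix x y assume xy: "x \<in> D" "y \<in> D" "h x = h y"
    obtain i j i' j' where ij: "x = (i, j)" "y = (i', j')" by (cases x, cases y)
    have bounds: "i < 2 * n" "i' < 2 * n" "j = 0 \<or> j = 1" "j' = 0 \<or> j' = 1"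
      using xy by (auto simp: ij D_def)
    have e: "a [^] i \<otimes> b [^] j = a [^] i' \<otimes> b [^] j'" using xy(3) by (simp add: h_def ij)
    have no: False if "a [^] (r::nat) \<otimes> b = a [^] (s::nat)" for r s
    proof -
      have "b = inv (a [^] r) \<otimes> a [^] s" using that by (metis ab inv_solve_left nat_pow_closed)
      moreover have "a [^] r \<in> generate G {a}" "a [^] s \<in> generate G {a}" using mem by blast+
      ultimately have "b \<in> generate G {a}" using generate_is_subgroup[of "{a}"]
        by (simp add: subgroup.m_closed subgroup.m_inv_closed)
      then show False using bA by simp
    qed
    have "j = j'" using bounds(3,4) e no[of i i'] no[of i' i] by auto
    then have "a [^] i = a [^] i'" using e by simp
    then have "i = i'" using bounds ord K by (simp add: nat_pow_eq_iff cong_def)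
    then show "x = y" using \<open>j = j'\<close> ij by simp
  qed
  have surj: "h ` D = carrier G"
  proof
    show "h ` D \<subseteq> carrier G" by (auto simp: h_def)
    show "carrier G \<subseteq> h ` D"
    proof
      fix y assume y: "y \<in> carrier G"
      obtain i j :: nat where ij: "y = a [^] i \<otimes> b [^] j" "j < 2"
      proof (cases "y \<in> generate G {a}")
        case True
        then obtain i :: nat where "y = a [^] i" using mem by blast
        then show ?thesis using that[of i 0] by simp
      next
        case False
        then obtain i :: nat where "y \<otimes> inv b = a [^] i" using cover y mem by blast
        then have "y = a [^] i \<otimes> b"
          using y by (metis ab inv_closed inv_solve_right' m_closed nat_pow_closed)
        then show ?thesis using that[of i 1] by simp
      qed
      have "a [^] i = a [^] (i mod (2 * n))" using ord K by (simp add: nat_pow_eq_iff cong_def)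
      then have "y = h (i mod (2 * n), j)" using ij by (simp add: h_def)
      moreover have "(i mod (2 * n), j) \<in> D" using ij n2 by (simp add: D_def)
      ultimately show "y \<in> h ` D" by blast
    qed
  qed
  have "Coset.order G = card D" unfolding Coset.order_def using surj inj card_image by metis
  then have order: "Coset.order G = 4 * n" by (simp add: D_def)
  define f where "f = (\<lambda>g. case g of Gen_a \<Rightarrow> a | Gen_b \<Rightarrow> b)"
  have f: "range f \<subseteq> carrier G" by (auto simp: f_def split: quaternion_gen.splits)
  have "a [^] (2 * n) = \<one>" using pow_ord_eq_1[OF ab(1)] ord K by simp
  moreover have "a \<otimes> b = b \<otimes> inv a"
  proof -
    have "a \<otimes> (b \<otimes> a) \<otimes> inv a = b \<otimes> inv a" unfolding twist by (simp add: m_assoc[symmetric])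
    then show ?thesis by (simp add: m_assoc)
  qed
  ultimately have R: "word_eval G f u = word_eval G f v" if "(u, v) \<in> quaternion_relations n" for u v
    using that b2 f unfolding quaternion_relations_def
    by (auto simp: word_eval_replicate f_def n_def)
  have eval: "word_eval G f (replicate i (Gen_a, True) @ replicate j (Gen_b, True)) = h (i, j)" for i j
    using f by (simp add: word_eval_append word_eval_replicate h_def) (simp add: f_def)
  have "word_cong (quaternion_relations n) u v" if uv: "word_eval G f u = word_eval G f v" for u v
  proof -
    let ?nf = "\<lambda>i j. replicate i (Gen_a, True) @ replicate j (Gen_b, True)"
    have n1: "n \<ge> 1" using n2 by simp
    obtain i j where u: "i < 2 * n" "j < 2" "word_cong (quaternion_relations n) u (?nf i j)"
      using quaternion_normal_form[OF n1] .
    obtain i' j' where v: "i' < 2 * n" "j' < 2" "word_cong (quaternion_relations n) v (?nf i' j')"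
      using quaternion_normal_form[OF n1] .
    have "h (i, j) = h (i', j')"
      using word_eval_cong[OF f R u(3)] word_eval_cong[OF f R v(3)] uv eval by simp
    then have "(i, j) = (i', j')" by (rule inj_onD[OF inj]) (use u v in \<open>auto simp: D_def\<close>)
    then show ?thesis using u(3) v(3) word_cong.sym word_cong.trans by blast
  qed
  moreover have "carrier G \<subseteq> range (word_eval G f)"
  proof
    fix y assume "y \<in> carrier G"
    then obtain i j where "y = h (i, j)" using surj by (metis imageE surj_pair)
    then show "y \<in> range (word_eval G f)" using eval by (metis rangeI)
  qed
  ultimately have "has_presentation G (quaternion_relations n)"
    unfolding has_presentation_def using f word_eval_cong[OF f R] word_eval_closed[OF f] by blast
  then show ?thesis unfolding generalized_quaternion_def
    using n2 order is_group n_def by blast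
qed

text \<open>Normal forms bound the order only from above. Since the order equals
  \<open>4 * n\<close>, they represent distinct elements, which is what makes \<open>z = a^n\<close>
  nontrivial.\<close>

lemma (in group) generalized_quaternion_central_involution:
  assumes "generalized_quaternion G"
  obtains z where "z \<in> carrier G" "z \<noteq> \<one>"
    "\<And>x. x \<in> carrier G \<Longrightarrow> x \<noteq> \<one> \<Longrightarrow> \<exists>l::nat. l > 0 \<and> z = x [^] l"
proof -
  obtain n m where n: "n \<ge> 2" "n = 2 ^ m" "Coset.order G = 4 * n"
    and "has_presentation G (quaternion_relations n)"
    using assms by (auto simp: generalized_quaternion_def)
  then obtain f where f: "range f \<subseteq> carrier G" "range (word_eval G f) = carrier G"
    and R: "\<And>u v. word_cong (quaternion_relations n) u v \<Longrightarrow> word_eval G f u = word_eval G f v"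
    by (auto simp: has_presentation_def)
  define a where "a = f Gen_a"
  define b where "b = f Gen_b"
  have [simp]: "a \<in> carrier G" "b \<in> carrier G" using f(1) by (auto simp: a_def b_def)
  note eval = word_eval_replicate[OF f(1)] word_eval_append[OF f(1)]
  have rel: "word_eval G f u = word_eval G f v" if "(u, v) \<in> quaternion_relations n" for u v
    using R word_cong.rel that by blast
  have a2n: "a [^] (2 * n) = \<one>"
    using rel[of "replicate (2 * n) (Gen_a, True)" "[]"]
    by (simp add: quaternion_relations_def eval a_def)
  have b2: "b [^] (2::nat) = a [^] n"
    using rel[of "replicate n (Gen_a, True)" "replicate 2 (Gen_b, True)"]
    by (simp add: quaternion_relations_def eval a_def b_def)
  have ab: "a \<otimes> b = b \<otimes> inv a"
    using rel[of "[(Gen_a, True), (Gen_b, True)]" "[(Gen_b, True), (Gen_a, False)]"] f(1)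
    by (simp add: quaternion_relations_def a_def b_def image_subset_iff)
  define h where "h = (\<lambda>(i::nat, j::nat). a [^] i \<otimes> b [^] j)"
  define D :: "(nat \<times> nat) set" where "D = {..<2 * n} \<times> {..<2}"
  have surj: "\<exists>i j. y = a [^] i \<otimes> b [^] j \<and> i < 2 * n \<and> j < (2::nat)" if y: "y \<in> carrier G" for y
  proof -
    obtain w where w: "y = word_eval G f w" using y f(2) by blast
    obtain i j where "i < 2 * n" "j < 2"
      "word_cong (quaternion_relations n) w (replicate i (Gen_a, True) @ replicate j (Gen_b, True))"
      using quaternion_normal_form[of n w] n(1) by auto
    then show ?thesis using R w by (auto simp: eval a_def b_def)
  qed
  have "carrier G \<subseteq> h ` D" using surj by (fastforce simp: h_def D_def)
  then have "h ` D = carrier G" by (auto simp: h_def)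
  then have "card (h ` D) = card D" using n(3) by (simp add: Coset.order_def D_def)
  then have inj: "inj_on h D" by (simp add: D_def eq_card_imp_inj_on)
  define z where "z = a [^] n"
  have "h (n, 0) \<noteq> h (0, 0)"
  proof
    assume "h (n, 0) = h (0, 0)"
    then have "(n, 0) = (0 :: nat, 0 :: nat)" by (rule inj_onD[OF inj]) (use n in \<open>auto simp: D_def\<close>)
    then show False using n(1) by simp
  qed
  then have z1: "z \<noteq> \<one>" by (simp add: h_def z_def)
  have ba: "b \<otimes> a = a [^] (2 * n - 1) \<otimes> b"
  proof -
    have "a [^] (2 * n - 1) \<otimes> a = \<one>"
      using a2n n(1) by (metis One_nat_def Suc_pred less_le_trans mult_pos_pos nat_pow_Suc pos2)
    then have inva: "inv a = a [^] (2 * n - 1)" by (simp add: inv_equality)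
    have "inv a \<otimes> (a \<otimes> b) \<otimes> a = inv a \<otimes> b" unfolding ab by (simp add: m_assoc)
    then have "b \<otimes> a = inv a \<otimes> b" by (simp add: m_assoc[symmetric])
    then show ?thesis unfolding inva .
  qed
  have "\<exists>l::nat. l > 0 \<and> z = x [^] l" if x: "x \<in> carrier G" "x \<noteq> \<one>" for x
  proof -
    obtain i j :: nat where ij: "x = a [^] i \<otimes> b [^] j" "i < 2 * n" "j < 2" using surj[OF x(1)] by blast
    show ?thesis
    proof (cases "j = 0")
      case True
      then have xi: "x = a [^] i" using ij by simp
      then have "i \<noteq> 0" using x(2) by (metis nat_pow_0)
      \<comment> \<open>With \<open>t\<close> the multiplicity of 2 in \<open>i\<close>, the power
        \<open>2 ^ (m - t)\<close> of \<open>x\<close> has exponent \<open>n\<close> times the odd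
        number \<open>c\<close>, which is \<open>n\<close> modulo \<open>2 * n\<close>.\<close>
      then obtain c where c: "i = 2 ^ multiplicity 2 i * c" "odd c"
        using multiplicity_decompose'[of i 2] by auto
      let ?t = "multiplicity 2 i"
      have "2 ^ ?t \<le> i" using \<open>i \<noteq> 0\<close> by (simp add: dvd_imp_le multiplicity_dvd)
      then have "(2::nat) ^ ?t < 2 ^ Suc m" using ij(2) n(2) by simp
      then have "?t < Suc m" by (rule power_less_imp_less_exp[rotated]) simp
      then have "?t \<le> m" by simp
      obtain d where d: "c = 2 * d + 1" using c(2) by (rule oddE)
      have "i * 2 ^ (m - ?t) = (2 ^ ?t * 2 ^ (m - ?t)) * c" using c(1) by (metis mult.commute mult.left_commute)
      also have "\<dots> = n + (2 * n) * d" using \<open>?t \<le> m\<close> by (simp add: power_add[symmetric] d n(2))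
      finally have "x [^] ((2::nat) ^ (m - ?t)) = a [^] (n + (2 * n) * d)" 
        unfolding xi by (simp add: nat_pow_pow)
      also have "\<dots> = a [^] n \<otimes> (a [^] (2 * n)) [^] d"
        by (simp add: nat_pow_mult nat_pow_pow)
      also have "\<dots> = z" by (simp add: a2n z_def)
      finally show ?thesis by (intro exI[of _ "2 ^ (m - ?t)"]) simp
    next
      case False
      then have "x = a [^] i \<otimes> b" using ij by (cases j) auto
      \<comment> \<open>The geometric sum is \<open>1 + (2 * n - 1)\<close>, so the powers of
        \<open>a\<close> cancel and every \<open>a^i b\<close> squares to
        \<open>b^2 = z\<close>.\<close>
      then have "x [^] (2::nat) = a [^] (i * (\<Sum>l<2. (2 * n - 1) ^ l)) \<otimes> b [^] (2::nat)"
        using nat_pow_twisted_mult[OF _ _ ba, of i 2] by simp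
      also have "(\<Sum>l<2. (2 * n - 1) ^ l) = 2 * n" using n(1) by (simp add: numeral_2_eq_2)
      also have "a [^] (i * (2 * n)) = \<one>"
        using a2n by (metis \<open>a \<in> carrier G\<close> mult.commute nat_pow_one nat_pow_pow)
      finally have "x [^] (2::nat) = z" by (simp add: b2 z_def)
      then show ?thesis by (intro exI[of _ 2]) simp
    qed
  qed
  then show ?thesis using that[of z] z1 by (simp add: z_def)
qed

section \<open>The power graph of a p-group\<close>

text \<open>The subgroups of a cyclic p-group form a chain, so the one of order \<open>p\<close>
  lies in every nontrivial one.\<close>

lemma (in group) prime_order_mem_generate_pow:
  assumes fin: "finite (carrier G)" and p: "prime p"
    and x: "x \<in> carrier G" "ord x = p ^ m"
    and u: "u \<in> generate G {x}" "u [^] p = \<one>" and k: "x [^] (k::nat) \<noteq> \<one>"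
  shows "u \<in> generate G {x [^] k}"
proof -
  obtain i :: nat where i: "u = x [^] i" using u mem_generate_singleton_iff[OF fin x(1)] by blast
  have nk: "\<not> p ^ m dvd k" using k x by (simp add: pow_eq_id)
  then have "k \<noteq> 0" by (metis dvd_0_right)
  then obtain c where c: "k = p ^ multiplicity p k * c" "\<not> p dvd c"
    using multiplicity_decompose'[of k p] p by (metis not_prime_unit)
  define t where "t = multiplicity p k"
  have k': "k = p ^ t * c" using c(1) by (simp add: t_def)
  have "t < m"
  proof (rule ccontr)
    assume "\<not> t < m"
    then have "p ^ m dvd p ^ t" by (intro le_imp_power_dvd) simp
    then show False using nk k' by (metis dvd_mult2)
  qed
  then obtain l where l: "m = Suc (t + l)" using less_imp_Suc_add by blast
  have "p ^ m dvd i * p" using u(2) x by (simp add: i nat_pow_pow pow_eq_id)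
  then have "p * p ^ (t + l) dvd p * i" by (simp add: l mult.commute)
  then have "p ^ (t + l) dvd i" using prime_gt_0_nat[OF p] by (simp add: nat_mult_dvd_cancel1)
  then obtain i' where i': "i = p ^ (t + l) * i'" by blast
  have "coprime c p" using c(2) p by (metis coprime_commute prime_imp_coprime)
  \<comment> \<open>An inverse of \<open>c\<close> modulo \<open>p\<close> is enough, since
    \<open>i\<close> is a multiple of \<open>p ^ (m - 1)\<close>.\<close>
  then obtain d where d: "[c * d = 1] (mod p)" using cong_solve_coprime_nat[of c p] by auto
  have "[c * d * i' = 1 * i'] (mod p)" using d by (rule cong_scalar_right)
  then have "[p ^ (t + l) * (c * d * i') = p ^ (t + l) * i'] (mod p ^ (t + l) * p)"
    by (simp add: cong_def mult_mod_right[symmetric])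
  then have "[k * (p ^ l * (d * i')) = i] (mod p ^ m)"
    by (simp add: k' i' l power_add mult_ac)
  then have "(x [^] k) [^] (p ^ l * (d * i')) = u"
    using x unfolding i by (simp add: nat_pow_pow nat_pow_eq_iff)
  then show ?thesis using mem_generate_singleton_iff[OF fin nat_pow_closed[OF x(1)]] by metis
qed

lemma (in group) power_graph_pair_graph:
  assumes "finite (carrier G)"
  shows "pair_graph (power_graph G)"
proof
  show "finite (pverts (power_graph G))" "finite (parcs (power_graph G))"
    using assms finite_subset[of "parcs (power_graph G)" "carrier G \<times> carrier G"]
    by (auto simp: power_graph_def)
  show "symmetric (with_proj (power_graph G))"
    by (auto simp: symmetric_def power_graph_def intro!: symI)
qed (auto simp: power_graph_def)

lemma (in group) one_dominating:
  assumes "finite (carrier G)" "x \<in> carrier G" "x \<noteq> \<one>"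
  shows "(\<one>, x) \<in> parcs (power_graph G)"
proof -
  have "ord x > 0" "\<one> = x [^] ord x" using ord_ge_1[OF assms(1,2)] assms by simp_all
  then show ?thesis using assms unfolding power_graph_def by auto
qed

lemma (in group) cyclic_or_quaternion_dominating:
  assumes fin: "finite (carrier G)" and card: "Coset.order G \<ge> 3"
    and "cyclic_group G \<or> generalized_quaternion G"
  obtains z where "z \<in> carrier G" "z \<noteq> \<one>"
    "\<And>x. x \<in> carrier G \<Longrightarrow> x \<noteq> z \<Longrightarrow> (z, x) \<in> parcs (power_graph G)"
  using assms(3)
proof
  assume "cyclic_group G"
  then obtain g where g: "g \<in> carrier G" "carrier G = range (\<lambda>n::int. g [^] n)"
    using cyclic_group by blast
  then have "generate G {g} = carrier G" using generate_pow[OF g(1)] by auto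
  then have pow: "\<exists>i::nat. x = g [^] i" if "x \<in> carrier G" for x
    using mem_generate_singleton_iff[OF fin g(1)] that by blast
  show ?thesis
  proof (rule that[OF g(1)])
    show "g \<noteq> \<one>"
    proof
      assume "g = \<one>"
      then have "carrier G = {\<one>}" using pow by fastforce
      then show False using card by (simp add: Coset.order_def)
    qed
    fix x assume x: "x \<in> carrier G" "x \<noteq> g"
    obtain i :: nat where "x = g [^] i" using pow[OF x(1)] by blast
    \<comment> \<open>Edges demand a positive exponent, while \<open>i\<close> may be 0.\<close>
    then have "x = g [^] (i + ord g)" using g(1) by (simp add: nat_pow_mult[symmetric])
    moreover have "i + ord g > 0" using ord_ge_1[OF fin g(1)] by simp
    ultimately show "(g, x) \<in> parcs (power_graph G)"
      using x g(1) unfolding power_graph_def by auto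
  qed
next
  assume "generalized_quaternion G"
  then obtain z where z: "z \<in> carrier G" "z \<noteq> \<one>"
    "\<And>x. x \<in> carrier G \<Longrightarrow> x \<noteq> \<one> \<Longrightarrow> \<exists>l::nat. l > 0 \<and> z = x [^] l"
    using generalized_quaternion_central_involution by blast
  show ?thesis
  proof (rule that[OF z(1,2)])
    fix x assume x: "x \<in> carrier G" "x \<noteq> z"
    show "(z, x) \<in> parcs (power_graph G)"
    proof (cases "x = \<one>")
      case True
      then have "(x, z) \<in> parcs (power_graph G)" using one_dominating[OF fin z(1,2)] by simp
      then show ?thesis by (auto simp: power_graph_def)
    next
      case False
      then show ?thesis using z(3)[OF x(1)] x z(1) by (auto simp: power_graph_def)
    qed
  qed
qed

text \<open>If \<open>v \<notin> \<langle>u\<rangle>\<close> for two elements of order \<open>p\<close>, then removing the identity separates the elements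
  whose unique subgroup of order \<open>p\<close> is \<open>\<langle>u\<rangle>\<close> from all the others.\<close>

lemma (in group) power_graph_two_subgroups:
  assumes pG: "p_group p G" and fin: "finite (carrier G)"
    and u: "u \<in> carrier G" "u \<noteq> \<one>" "u [^] p = \<one>"
    and v: "v \<in> carrier G" "v [^] p = \<one>" "v \<notin> generate G {u}"
  shows "laplacian_multiplicity (power_graph G) (real (Coset.order G)) = 1"
    and "algebraic_connectivity (power_graph G) = 1"
proof -
  have p: "prime p" using pG by (simp add: p_group_def)
  interpret P: pair_graph "power_graph G" by (rule power_graph_pair_graph[OF fin])
  note mem = mem_generate_singleton_iff[OF fin]
  define U where "U = {x \<in> carrier G. x \<noteq> \<one> \<and> u \<in> generate G {x}}"
  define W where "W = {x \<in> carrier G. x \<noteq> \<one> \<and> u \<notin> generate G {x}}"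
  have "u \<in> U" using u by (simp add: U_def generate.incl)
  moreover have "v \<in> W"
  proof -
    have "v \<noteq> \<one>" using v(3) mem[OF u(1)] by (metis nat_pow_0)
    \<comment> \<open>\<open>v\<close> has prime order, so a nontrivial \<open>u\<close> in its
      subgroup would generate \<open>v\<close> in turn.\<close>
    moreover have "u \<notin> generate G {v}"
    proof
      assume uv: "u \<in> generate G {v}"
      then obtain i :: nat where i: "u = v [^] i" using mem[OF v(1)] by blast
      have "ord v dvd p" using v by (simp add: pow_eq_id)
      then have "ord v = p ^ 1" using p v(1) \<open>v \<noteq> \<one>\<close> ord_eq_1 prime_nat_iff by auto
      moreover have "v \<in> generate G {v}" by (simp add: generate.incl)
      ultimately have "v \<in> generate G {v [^] i}"
        using v(2) i u(2) by (intro prime_order_mem_generate_pow[OF fin p v(1), where m = 1]) simp_all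
      then show False using v(3) i by simp
    qed
    ultimately show ?thesis using v by (simp add: W_def)
  qed
  moreover have "pverts (power_graph G) = insert \<one> (U \<union> W)"
    by (auto simp: power_graph_def U_def W_def)
  moreover have "(\<one>, x) \<in> parcs (power_graph G)" if "x \<in> U \<union> W" for x
    using that one_dominating[OF fin] by (auto simp: U_def W_def)
  moreover have "(x, y) \<notin> parcs (power_graph G)" if xy: "x \<in> U" "y \<in> W" for x y
  proof
    assume "(x, y) \<in> parcs (power_graph G)"
    then obtain k :: nat where "x = y [^] k \<or> y = x [^] k" by (auto simp: power_graph_def)
    \<comment> \<open>If \<open>x\<close> is a power of \<open>y\<close>, membership passes on
      directly. If \<open>y\<close> is a power of \<open>x\<close>, it is a nontrivial one, and its
      subgroup still contains the subgroup of order \<open>p\<close>.\<close>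
    then have "u \<in> generate G {y}"
    proof
      assume k: "x = y [^] k"
      have yC: "y \<in> carrier G" using xy by (simp add: W_def)
      obtain i :: nat where "u = x [^] i" using xy mem[of x u] by (auto simp: U_def)
      then have "u = y [^] (k * i)" using k yC by (simp add: nat_pow_pow)
      then show ?thesis using mem[OF yC] by blast
    next
      assume k: "y = x [^] k"
      obtain m where "ord x = p ^ m" using pG xy by (auto simp: p_group_def U_def)
      then show ?thesis
        using xy k u prime_order_mem_generate_pow[OF fin p, of x m u k] by (auto simp: U_def W_def)
    qed
    then show False using xy by (simp add: W_def)
  qed
  moreover have "\<one> \<notin> U" "\<one> \<notin> W" "U \<inter> W = {}" by (auto simp: U_def W_def)
  moreover have "card (pverts (power_graph G)) = Coset.order G"
    by (simp add: power_graph_def Coset.order_def)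
  ultimately show "laplacian_multiplicity (power_graph G) (real (Coset.order G)) = 1"
    and "algebraic_connectivity (power_graph G) = 1"
    using P.dominating_cut_vertex[of \<one> U W] by auto
qed

lemma (in group) noncyclic_nonquaternion_two_subgroups:
  assumes pG: "p_group p G" and fin: "finite (carrier G)"
    and "\<not> cyclic_group G" "\<not> generalized_quaternion G"
  obtains u v where "u \<in> carrier G" "u \<noteq> \<one>" "u [^] p = \<one>"
    "v \<in> carrier G" "v [^] p = \<one>" "v \<notin> generate G {u}"
proof (rule ccontr)
  assume contra: "\<not> thesis"
  note two = that
  have uniq: "v \<in> generate G {u}" if "u \<in> carrier G" "v \<in> carrier G" "u \<noteq> \<one>"
    "u [^] p = \<one>" "v [^] p = \<one>" for u v
    using two contra that by blast
  have "generalized_quaternion G"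
  proof (rule noncyclic_p_group_unique_subgroup[OF pG fin assms(3) uniq])
    fix a b and k :: nat
    assume "a \<in> carrier G" "b \<in> carrier G" "k \<ge> 2" "ord a = 2 ^ k" "b \<notin> generate G {a}"
      "b \<otimes> a = inv a \<otimes> b" "b [^] (2::nat) = a [^] (2 ^ (k - 1) :: nat)"
      "\<And>y. y \<in> carrier G \<Longrightarrow> y \<in> generate G {a} \<or> y \<otimes> inv b \<in> generate G {a}"
    then show ?thesis by (rule generalized_quaternionI[OF fin])
  qed
  then show False using assms(4) by simp
qed

theorem theorem3p14:
  fixes G :: "('a, 'b) monoid_scheme" and p n :: nat
  assumes "p_group p G"
    and "finite (carrier G)"
    and "Coset.order G = n"
    and "n \<ge> 3"
  shows "(algebraic_connectivity (power_graph G) = 1 \<longleftrightarrow>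
            laplacian_multiplicity (power_graph G) (real n) = 1) \<and>
         (laplacian_multiplicity (power_graph G) (real n) = 1 \<longleftrightarrow>
            \<not> cyclic_group G \<and> \<not> generalized_quaternion G)"
proof -
  interpret group G using assms(1) by (simp add: p_group_def)
  interpret P: pair_graph "power_graph G" by (rule power_graph_pair_graph[OF assms(2)])
  have card: "card (pverts (power_graph G)) = n"
    using assms(3) by (simp add: power_graph_def Coset.order_def)
  show ?thesis
  \<comment> \<open>Each case decides the algebraic connectivity and the multiplicity together, so
    this one split gives both equivalences.\<close>
  proof (cases "cyclic_group G \<or> generalized_quaternion G")
    case True
    then obtain z where z: "z \<in> carrier G" "z \<noteq> \<one>\<^bsub>G\<^esub>"
      "\<And>x. x \<in> carrier G \<Longrightarrow> x \<noteq> z \<Longrightarrow> (z, x) \<in> parcs (power_graph G)"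
      using cyclic_or_quaternion_dominating assms by blast
    have "laplacian_multiplicity (power_graph G) (real n) \<noteq> 1"
      "algebraic_connectivity (power_graph G) \<noteq> 1"
      using P.two_dominating_vertices[of "\<one>\<^bsub>G\<^esub>" z] z one_dominating[OF assms(2)] assms(4)
      unfolding card by (auto simp: power_graph_def)
    then show ?thesis using True by simp
  next
    case False
    then obtain u v where "u \<in> carrier G" "u \<noteq> \<one>\<^bsub>G\<^esub>" "u [^]\<^bsub>G\<^esub> p = \<one>\<^bsub>G\<^esub>"
      "v \<in> carrier G" "v [^]\<^bsub>G\<^esub> p = \<one>\<^bsub>G\<^esub>" "v \<notin> generate G {u}"
      using noncyclic_nonquaternion_two_subgroups[OF assms(1,2)] by blast
    then show ?thesis
      using power_graph_two_subgroups[OF assms(1,2)] assms(3) False by blast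
  qed
qed

end
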